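(* Let $p\ge 1$ be an integer, let $m>0$ be irrational, and let $k_0\ge 2$ be an integer. Then there exist $M=M(p,m,k_0)>0$, $c=c(p,m,k_0)>0$, a constant $C>0$ independent of $\rho$, and a Sobolev index $s\in[k_0+10,k_0+20]$ such that for each $\rho\in(0,M)$ there are $\alpha\ge c\,\rho^{2p}$ and $\omega>0$ with $\omega\approx\sqrt{1+m}$ for which the damped nonlinear wave equation $$\begin{cases}\partial_t^2u-\partial_x^2u-\alpha\,\partial_t\partial_x^2u+mu=(\partial_tu)^{2p+1}, & t\in\mathbb{R},\ x\in\mathbb{T}=\mathbb{R}/2\pi\mathbb{Z},\\ u(t,0)=u(t,\pi)=0\end{cases}$$ has a $\frac{2\pi}{\omega}$-time periodic solution $u$, of class $C^{k_0}$ in $(t,x)$, of the form $$u(t,x)=\rho\cos(\omega t)\sin(x)+v(\omega t,x),$$ where $(t,x)\mapsto v(t,x)$ is $2\pi$-periodic in $t$ and $\|v\|_{H^s(\mathbb{T}^2)}\le C\rho^{2p+\frac12}$.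
   Context: $\mathbb{T}=\mathbb{R}/2\pi\mathbb{Z}$ and $H^s(\mathbb{T}^2)$ is the usual Sobolev space of functions of $(t,x)$ that are $2\pi$-periodic in both variables. The notation $x\approx y$ means: there is an $\epsilon>0$ for which $|x-y|<\epsilon$. *)

theory Defs
  imports "HOL-Analysis.Analysis"
begin

definition has_dt :: "(real \<Rightarrow> real \<Rightarrow> real) \<Rightarrow> (real \<Rightarrow> real \<Rightarrow> real) \<Rightarrow> bool" where
  "has_dt u u' \<longleftrightarrow> (\<forall>t x. ((\<lambda>\<tau>. u \<tau> x) has_real_derivative u' t x) (at t))"

definition has_dx :: "(real \<Rightarrow> real \<Rightarrow> real) \<Rightarrow> (real \<Rightarrow> real \<Rightarrow> real) \<Rightarrow> bool" where
  "has_dx u u' \<longleftrightarrow> (\<forall>t x. (u t has_real_derivative u' t x) (at x))"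

text \<open>Class \<open>C\<^sup>k\<close> jointly in \<open>(t,x)\<close>: all partial derivatives of order \<open>k\<close> exist and are jointly
  continuous. Those of lower order are then continuous as well, having continuous partial
  derivatives themselves.\<close>

primrec C_class :: "nat \<Rightarrow> (real \<Rightarrow> real \<Rightarrow> real) \<Rightarrow> bool" where
  "C_class 0 u \<longleftrightarrow> continuous_on UNIV (\<lambda>(t, x). u t x)"
| "C_class (Suc k) u \<longleftrightarrow>
     (\<exists>ut ux. has_dt u ut \<and> has_dx u ux \<and> C_class k ut \<and> C_class k ux)"

text \<open>Functions on \<open>\<real>/2\<pi>\<int>\<close> are represented by \<open>2\<pi>\<close>-periodic functions on \<open>\<real>\<close>.\<close>

definition periodic_t :: "real \<Rightarrow> (real \<Rightarrow> real \<Rightarrow> real) \<Rightarrow> bool" where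
  "periodic_t T u \<longleftrightarrow> (\<forall>t x. u (t + T) x = u t x)"

definition periodic_x :: "real \<Rightarrow> (real \<Rightarrow> real \<Rightarrow> real) \<Rightarrow> bool" where
  "periodic_x L u \<longleftrightarrow> (\<forall>t x. u t (x + L) = u t x)"

text \<open>Classical solutions: every derivative in the equation, including the third order mixed one,
  exists everywhere (which \<open>C\<^sup>2\<close> alone would not guarantee).\<close>

definition damped_wave_solution ::
    "nat \<Rightarrow> real \<Rightarrow> real \<Rightarrow> (real \<Rightarrow> real \<Rightarrow> real) \<Rightarrow> bool" where
  "damped_wave_solution p m \<alpha> u \<longleftrightarrow>
     periodic_x (2 * pi) u \<and>
     (\<exists>ut utt ux uxx uxxt.
        has_dt u ut \<and> has_dt ut utt \<and> has_dx u ux \<and> has_dx ux uxx \<and> has_dt uxx uxxt \<and>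
        (\<forall>t x. utt t x - uxx t x - \<alpha> * uxxt t x + m * u t x = ut t x ^ (2 * p + 1))) \<and>
     (\<forall>t. u t 0 = 0 \<and> u t pi = 0)"

definition torus_box :: "(real \<times> real) set" where
  "torus_box = cbox (0, 0) (2 * pi, 2 * pi)"

definition fourier_coeff :: "(real \<Rightarrow> real \<Rightarrow> real) \<Rightarrow> int \<Rightarrow> int \<Rightarrow> complex" where
  "fourier_coeff f l j =
     (LINT (t, x) | lebesgue_on torus_box.
        complex_of_real (f t x) * cis (- (of_int l * t + of_int j * x))) / of_real ((2 * pi)\<^sup>2)"

definition sobolev_weight :: "real \<Rightarrow> (real \<Rightarrow> real \<Rightarrow> real) \<Rightarrow> int \<times> int \<Rightarrow> real" where
  "sobolev_weight s f = (\<lambda>(l, j).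
     (1 + (of_int l)\<^sup>2 + (of_int j)\<^sup>2) powr s * (norm (fourier_coeff f l j))\<^sup>2)"

text \<open>\<open>H\<^sup>s\<close> of the two-dimensional torus, for \<open>s \<ge> 0\<close>, as a subspace of \<open>L\<^sup>2\<close>.\<close>

definition in_sobolev :: "real \<Rightarrow> (real \<Rightarrow> real \<Rightarrow> real) \<Rightarrow> bool" where
  "in_sobolev s f \<longleftrightarrow>
     periodic_t (2 * pi) f \<and> periodic_x (2 * pi) f \<and>
     (\<lambda>(t, x). f t x) \<in> borel_measurable (lebesgue_on torus_box) \<and>
     integrable (lebesgue_on torus_box) (\<lambda>(t, x). (f t x)\<^sup>2) \<and>
     sobolev_weight s f summable_on UNIV"

definition sobolev_norm :: "real \<Rightarrow> (real \<Rightarrow> real \<Rightarrow> real) \<Rightarrow> real" where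
  "sobolev_norm s f = sqrt (infsum (sobolev_weight s f) UNIV)"

end

theory Submission
  imports Defs
begin

text \<open>
  Write \<open>u(t,x) = U(\<omega>t,x)\<close>. On the mode \<open>exp(i(l\<tau> + jx))\<close> the linear part of the equation is
  multiplication by \<open>\<omega> D(l,j)\<close> with the divisor \<open>D(l,j) = (j\<^sup>2 + m)/\<omega> - \<omega> l\<^sup>2 + i \<alpha> l j\<^sup>2\<close>. For
  \<open>\<omega> = sqrt (1 + m)\<close> its real part vanishes only at the four resonant modes \<open>|l| = |j| = 1\<close>, because
  \<open>m\<close> is irrational, but it may come arbitrarily close to zero at high modes near the cone
  \<open>|j| = \<omega> |l|\<close>. There the damping helps: \<open>|D| \<ge> \<alpha> |l| j\<^sup>2\<close>.

  Let \<open>g\<close> be the size \<open>\<rho>\<^sup>2\<^sup>p\<close> (up to a constant) of the derivative of the nonlinearity. In terms of the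
  velocity \<open>\<partial>\<^sub>t u\<close> the equation off the resonant modes is a fixed point equation whose linear part is the
  multiplier \<open>i g l / D\<close>. The damping turns out to be comparable to \<open>g\<close>, so this multiplier is
  \<open>O(1/j\<^sup>2)\<close> near the cone; on the finitely many modes of bounded frequency near the cone it is \<open>O(g)\<close>
  by irrationality; away from the cone it is \<open>O(g)\<close> as well. Hence it is as small as desired once
  \<open>g\<close> is small (\<open>divisor_bound\<close>). There is no loss of derivatives, and an ordinary contraction works in a
  Banach algebra of Fourier series, here the one with the weight \<open>exp(|l| + |j|)\<close>, whose elements lie
  in every \<open>C\<^sup>k\<close> and every \<open>H\<^sup>s\<close>.

  The velocity is sought as \<open>r (q\<^sub>0 + z)\<close> with \<open>q\<^sub>0 = - sin \<tau> sin x\<close>, with \<open>r = \<rho> sqrt (1 + m)\<close>, so that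
  \<open>g = r\<^sup>2\<^sup>p\<close>, and with \<open>z\<close> free of resonant modes. The resonant part of the equation is one complex
  equation, \<open>D(1,1) = 4 i g c\<close>, where \<open>c\<close> is the \<open>(1,1)\<close> coefficient of \<open>(q\<^sub>0 + z)\<^sup>2\<^sup>p\<^sup>+\<^sup>1\<close>. Its imaginary part
  gives \<open>\<alpha> = 4 g Re c\<close> and its real part a quadratic equation for \<open>\<omega>\<close>, so both parameters are explicit
  functions of \<open>z\<close> and the contraction is in \<open>z\<close> alone. At \<open>z = 0\<close> the number \<open>c\<close> is the square of a
  nonzero real number (\<open>coef_wpow_q0_resonant\<close>), which yields the lower bound for \<open>\<alpha>\<close>. Fixing the amplitude
  of the velocity instead of that of \<open>u\<close> is what makes \<open>\<omega>\<close> explicit; the resonant part of \<open>u\<close> then has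
  amplitude \<open>r/\<omega> = \<rho> + O(\<rho>\<^sup>2\<^sup>p\<^sup>+\<^sup>1)\<close>, and the difference goes into \<open>v\<close>.

  For the size of \<open>v\<close> observe that \<open>q\<^sub>0\<^sup>2\<^sup>p\<^sup>+\<^sup>1\<close> is a trigonometric polynomial. On its nonresonant modes the
  divisor is bounded away from zero independently of \<open>g\<close>, so the fixed point satisfies \<open>z = O(g)\<close>, and
  \<open>v = O(\<rho>\<^sup>2\<^sup>p\<^sup>+\<^sup>1)\<close>.
\<close>

section \<open>The weighted Wiener algebra\<close>

text \<open>
  The exponential weight is submultiplicative and dominates all polynomials, so that one space serves
  all orders of differentiability at once.
\<close>

definition wt :: "int \<times> int \<Rightarrow> real" where
  "wt k = exp (\<bar>of_int (fst k)\<bar> + \<bar>of_int (snd k)\<bar>)"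

lemma wt_pos [simp]: "wt k > 0" and wt_ge_one [simp]: "wt k \<ge> 1"
  and wt_nonneg [simp]: "wt k \<ge> 0"
  by (simp_all add: wt_def)

lemma wt_submult: "wt (n + k) \<le> wt n * wt k"
  unfolding wt_def exp_add[symmetric] by (simp add: abs_triangle_ineq)

typedef wiener = "{a :: int \<times> int \<Rightarrow> complex. (\<lambda>k. wt k * cmod (a k)) summable_on UNIV}"
  morphisms coef series
  by (rule exI[of _ "\<lambda>_. 0"]) auto

setup_lifting type_definition_wiener

lemma coef_summable: "(\<lambda>k. wt k * cmod (coef a k)) summable_on UNIV"
  using coef[of a] by simp

lemma coef_series:
  "(\<lambda>k. wt k * cmod (a k)) summable_on UNIV \<Longrightarrow> coef (series a) = a"
  by (simp add: series_inverse)

lemma wiener_eqI: "(\<And>k. coef a k = coef b k) \<Longrightarrow> a = b"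
  by (metis coef_inject ext)

lemma series_dominated:
  assumes "f summable_on UNIV" "\<And>k. wt k * cmod (a k) \<le> f k"
  shows "coef (series a) = a"
  by (rule coef_series, rule summable_on_comparison_test[OF assms(1)]) (use assms(2) in auto)

instantiation wiener :: real_normed_vector
begin

lift_definition zero_wiener :: wiener is "\<lambda>_. 0" by simp

lift_definition plus_wiener :: "wiener \<Rightarrow> wiener \<Rightarrow> wiener" is "\<lambda>a b k. a k + b k"
proof -
  fix a b :: "int \<times> int \<Rightarrow> complex"
  assume "(\<lambda>k. wt k * cmod (a k)) summable_on UNIV" "(\<lambda>k. wt k * cmod (b k)) summable_on UNIV"
  from summable_on_add[OF this] show "(\<lambda>k. wt k * cmod (a k + b k)) summable_on UNIV"
    by (rule summable_on_comparison_test)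
       (auto simp: distrib_left[symmetric] intro!: mult_left_mono norm_triangle_ineq)
qed

lift_definition uminus_wiener :: "wiener \<Rightarrow> wiener" is "\<lambda>a k. - a k" by simp

definition "a - b = a + (- b)" for a b :: wiener

lift_definition scaleR_wiener :: "real \<Rightarrow> wiener \<Rightarrow> wiener" is "\<lambda>c a k. c *\<^sub>R a k"
  using summable_on_cmult_right by (fastforce simp: mult.left_commute)

definition norm_wiener :: "wiener \<Rightarrow> real" where
  "norm a = (\<Sum>\<^sub>\<infinity>k. wt k * cmod (coef a k))"

definition "dist a b = norm (a - b)" for a b :: wiener
definition "sgn a = inverse (norm a) *\<^sub>R a" for a :: wiener
definition [code del]: "(uniformity :: (wiener \<times> wiener) filter) = (INF e\<in>{0<..}. principal {(x, y). dist x y < e})"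
definition [code del]: "open (U :: wiener set) \<longleftrightarrow> (\<forall>x\<in>U. eventually (\<lambda>(x', y). x' = x \<longrightarrow> y \<in> U) uniformity)"

lemma norm_coef_le: "wt k * cmod (coef a k) \<le> norm a"
  using finite_sum_le_infsum[OF coef_summable, of "{k}" a] by (simp add: norm_wiener_def)

instance
proof
  fix a b c :: wiener and r s :: real
  show "a + b + c = a + (b + c)" "a + b = b + a" "0 + a = a"
    by (transfer; simp add: algebra_simps)+
  show "- a + a = 0" by transfer simp
  show "a - b = a + - b" by (simp add: minus_wiener_def)
  show "r *\<^sub>R (a + b) = r *\<^sub>R a + r *\<^sub>R b" "(r + s) *\<^sub>R a = r *\<^sub>R a + s *\<^sub>R a"
    "r *\<^sub>R s *\<^sub>R a = (r * s) *\<^sub>R a" "1 *\<^sub>R a = a"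
    by (transfer; simp add: algebra_simps)+
  show "dist a b = norm (a - b)" by (rule dist_wiener_def)
  show "sgn a = inverse (norm a) *\<^sub>R a" by (rule sgn_wiener_def)
  show "(uniformity :: (wiener \<times> wiener) filter) = (INF e\<in>{0<..}. principal {(x, y). dist x y < e})"
    by (rule uniformity_wiener_def)
  show "open U \<longleftrightarrow> (\<forall>x\<in>U. eventually (\<lambda>(x', y). x' = x \<longrightarrow> y \<in> U) uniformity)" for U :: "wiener set"
    by (rule open_wiener_def)
  show "norm a = 0 \<longleftrightarrow> a = 0"
  proof
    assume "norm a = 0"
    have "coef a k = 0" for k
    proof -
      have "1 * cmod (coef a k) \<le> wt k * cmod (coef a k)"
        by (intro mult_right_mono) auto
      also have "\<dots> \<le> 0" using norm_coef_le[of k a] \<open>norm a = 0\<close> by simp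
      finally show ?thesis by simp
    qed
    then show "a = 0"
      by (intro wiener_eqI) (simp add: zero_wiener.rep_eq)
  qed (simp add: norm_wiener_def zero_wiener.rep_eq)
  show "norm (a + b) \<le> norm a + norm b"
    unfolding norm_wiener_def infsum_add[OF coef_summable coef_summable, symmetric]
    by (intro infsum_mono coef_summable summable_on_add)
       (auto simp: plus_wiener.rep_eq distrib_left[symmetric] intro!: mult_left_mono norm_triangle_ineq)
  show "norm (r *\<^sub>R a) = \<bar>r\<bar> * norm a"
    by (simp add: norm_wiener_def scaleR_wiener.rep_eq infsum_cmult_right'[symmetric] mult_ac)
qed

end

lemma coef_zero [simp]: "coef 0 k = 0"
  and coef_add [simp]: "coef (a + b) k = coef a k + coef b k"
  and coef_minus [simp]: "coef (- a) k = - coef a k"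
  and coef_diff [simp]: "coef (a - b) k = coef a k - coef b k"
  and coef_scaleR [simp]: "coef (r *\<^sub>R a) k = r *\<^sub>R coef a k"
  by (simp_all add: zero_wiener.rep_eq plus_wiener.rep_eq uminus_wiener.rep_eq
      minus_wiener_def scaleR_wiener.rep_eq del: add_uminus_conv_diff)

lemma cmod_coef_le: "cmod (coef a k) \<le> norm a"
proof -
  have "1 * cmod (coef a k) \<le> wt k * cmod (coef a k)"
    by (intro mult_right_mono) auto
  then show ?thesis using norm_coef_le[of k a] by simp
qed

lemma norm_wiener_le_finite_sums:
  assumes "\<And>S. finite S \<Longrightarrow> (\<Sum>k\<in>S. wt k * cmod (a k)) \<le> B"
  shows "coef (series a) = a" "norm (series a) \<le> B"
proof -
  have s: "(\<lambda>k. wt k * cmod (a k)) summable_on UNIV"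
    by (rule nonneg_bdd_above_summable_on) (auto intro!: bdd_aboveI2[where M = B] assms)
  then show *: "coef (series a) = a" by (rule coef_series)
  show "norm (series a) \<le> B"
    unfolding norm_wiener_def * by (rule infsum_le_finite_sums[OF s]) (use assms in auto)
qed

lemma sum_le_norm_wiener: "finite S \<Longrightarrow> (\<Sum>k\<in>S. wt k * cmod (coef a k)) \<le> norm a"
  unfolding norm_wiener_def by (rule finite_sum_le_infsum[OF coef_summable]) auto

text \<open>
  Limits are taken coefficientwise. The Cauchy estimate holds for each finite partial sum of the
  weighted norm, survives the limit there, and hence bounds the full sum.
\<close>

instance wiener :: banach
proof
  fix X :: "nat \<Rightarrow> wiener"
  assume C: "Cauchy X"
  have "Cauchy (\<lambda>n. coef (X n) k)" for k
    unfolding Cauchy_def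
  proof (intro allI impI)
    fix e :: real assume "e > 0"
    with C obtain N where N: "\<And>m n. m \<ge> N \<Longrightarrow> n \<ge> N \<Longrightarrow> dist (X m) (X n) < e"
      unfolding Cauchy_def by blast
    have "dist (coef (X m) k) (coef (X n) k) < e" if "m \<ge> N" "n \<ge> N" for m n
      using cmod_coef_le[of "X m - X n" k] N[OF that] by (simp add: dist_norm)
    then show "\<exists>N. \<forall>m\<ge>N. \<forall>n\<ge>N. dist (coef (X m) k) (coef (X n) k) < e" by blast
  qed
  then have "\<exists>l. (\<lambda>n. coef (X n) k) \<longlonglongrightarrow> l" for k
    by (simp add: Cauchy_convergent_iff convergent_def)
  then obtain L where L: "\<And>k. (\<lambda>n. coef (X n) k) \<longlonglongrightarrow> L k" by metis
  have est: "\<exists>N. \<forall>n\<ge>N. coef (series (\<lambda>k. L k - coef (X n) k)) = (\<lambda>k. L k - coef (X n) k)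
     \<and> norm (series (\<lambda>k. L k - coef (X n) k)) \<le> e" if "e > 0" for e
  proof -
    from C \<open>e > 0\<close> obtain N where N: "\<And>m n. m \<ge> N \<Longrightarrow> n \<ge> N \<Longrightarrow> dist (X m) (X n) < e"
      unfolding Cauchy_def by blast
    have "(\<Sum>k\<in>S. wt k * cmod (L k - coef (X n) k)) \<le> e" if "n \<ge> N" "finite S" for n S
    proof (rule tendsto_upperbound)
      show "(\<lambda>m. \<Sum>k\<in>S. wt k * cmod (coef (X m) k - coef (X n) k))
              \<longlonglongrightarrow> (\<Sum>k\<in>S. wt k * cmod (L k - coef (X n) k))"
        by (intro tendsto_intros L)
      show "\<forall>\<^sub>F m in sequentially. (\<Sum>k\<in>S. wt k * cmod (coef (X m) k - coef (X n) k)) \<le> e"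
        using eventually_ge_at_top[of N]
      proof eventually_elim
        case (elim m)
        show ?case
          using sum_le_norm_wiener[OF \<open>finite S\<close>, of "X m - X n"] N[OF elim \<open>n \<ge> N\<close>]
          by (simp add: dist_norm)
      qed
    qed simp
    note bnd = this
    have "coef (series (\<lambda>k. L k - coef (X n) k)) = (\<lambda>k. L k - coef (X n) k)
        \<and> norm (series (\<lambda>k. L k - coef (X n) k)) \<le> e" if "n \<ge> N" for n
      using norm_wiener_le_finite_sums[where a = "\<lambda>k. L k - coef (X n) k" and B = e, OF bnd[OF that]]
      by simp
    then show ?thesis by (intro exI[of _ N]) simp
  qed
  obtain N where "coef (series (\<lambda>k. L k - coef (X N) k)) = (\<lambda>k. L k - coef (X N) k)"
    using est[of 1] by auto
  then have "coef (series (\<lambda>k. L k - coef (X N) k) + X N) = L" by (simp add: fun_eq_iff)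
  then obtain Y where Y: "coef Y = L" by blast
  have L': "coef (series L) = L" unfolding Y[symmetric] coef_inverse ..
  have eq: "series (\<lambda>k. L k - coef (X n) k) = series L - X n"
    if "coef (series (\<lambda>k. L k - coef (X n) k)) = (\<lambda>k. L k - coef (X n) k)" for n
    by (rule wiener_eqI) (simp add: that L')
  have "X \<longlonglongrightarrow> series L"
  proof (rule LIMSEQ_I)
    fix e :: real assume "e > 0"
    then obtain M where "\<forall>n\<ge>M. coef (series (\<lambda>k. L k - coef (X n) k)) = (\<lambda>k. L k - coef (X n) k)
       \<and> norm (series (\<lambda>k. L k - coef (X n) k)) \<le> e / 2"
      using est[of "e / 2"] by auto
    with eq have "norm (series L - X n) \<le> e / 2" if "n \<ge> M" for n using that by metis
    then have "\<forall>n\<ge>M. norm (X n - series L) < e"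
      using \<open>e > 0\<close> by (metis (no_types) field_sum_of_halves less_add_same_cancel1 norm_minus_commute order_le_less_trans half_gt_zero)
    then show "\<exists>M. \<forall>n\<ge>M. norm (X n - series L) < e" ..
  qed
  then show "convergent X" by (auto simp: convergent_def)
qed

subsection \<open>Multipliers\<close>

text \<open>
  A Fourier multiplier. It is used only where it maps into the space, which the domination hypothesis of
  the following lemma ensures; asking for domination on the given \<open>a\<close> alone allows multipliers that are
  under control only on the support of \<open>a\<close>.
\<close>

definition diag :: "(int \<times> int \<Rightarrow> complex) \<Rightarrow> wiener \<Rightarrow> wiener" where
  "diag f a = series (\<lambda>k. f k * coef a k)"

lemma
  assumes "\<And>k. cmod (f k * coef a k) \<le> B * cmod (coef a k)"
  shows coef_diag: "coef (diag f a) k = f k * coef a k"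
    and norm_diag_le: "norm (diag f a) \<le> B * norm a"
proof -
  have le: "wt k * cmod (f k * coef a k) \<le> B * (wt k * cmod (coef a k))" for k
    using mult_left_mono[OF assms[of k], of "wt k"] by (simp add: mult_ac)
  have s: "(\<lambda>k. B * (wt k * cmod (coef a k))) summable_on UNIV"
    by (intro summable_on_cmult_right coef_summable)
  have c: "coef (diag f a) = (\<lambda>k. f k * coef a k)"
    unfolding diag_def by (rule series_dominated[OF s le])
  then show "coef (diag f a) k = f k * coef a k" by simp
  have "norm (diag f a) \<le> (\<Sum>\<^sub>\<infinity>k. B * (wt k * cmod (coef a k)))"
    unfolding norm_wiener_def by (intro infsum_mono coef_summable s) (simp add: c le)
  then show "norm (diag f a) \<le> B * norm a"
    by (simp add: norm_wiener_def infsum_cmult_right')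
qed

subsection \<open>Convolution\<close>

text \<open>
  The map \<open>(k, n) \<mapsto> (n, k - n)\<close> is a bijection of the index pairs and turns the double sum into a product.
  Applied to weighted moduli this gives the norm inequality for convolutions; applied to the terms of two
  Fourier series it shows that evaluation is multiplicative.
\<close>

lemma double_sum_convolution:
  fixes f g :: "int \<times> int \<Rightarrow> 'a::{real_normed_field, banach}"
  assumes f: "f abs_summable_on UNIV" and g: "g abs_summable_on UNIV"
  shows "(\<lambda>(k, n). f n * g (k - n)) abs_summable_on UNIV"
    and "(\<Sum>\<^sub>\<infinity>k. \<Sum>\<^sub>\<infinity>n. f n * g (k - n)) = infsum f UNIV * infsum g UNIV"
    and "(\<lambda>k. \<Sum>\<^sub>\<infinity>n. f n * g (k - n)) summable_on UNIV"
proof -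
  have "(\<lambda>(n, m). f n * g m) abs_summable_on UNIV \<times> UNIV"
    unfolding Infinite_Sum.abs_summable_on_Sigma_iff
    using f g by (auto simp: norm_mult abs_mult infsum_cmult_right' intro: summable_on_cmult_right summable_on_cmult_left)
  then have P: "(\<lambda>(n, m). f n * g m) abs_summable_on UNIV" unfolding UNIV_Times_UNIV .
  have "(\<lambda>x. norm (case x of (k, n) \<Rightarrow> f n * g (k - n))) summable_on UNIV
     \<longleftrightarrow> (\<lambda>x. norm (case x of (n, m) \<Rightarrow> f n * g m)) summable_on UNIV"
    by (rule summable_on_reindex_bij_witness[where i = "\<lambda>(n, m). (n + m, n)" and j = "\<lambda>(k, n). (n, k - n)"])
       (auto simp: split_def simp del: fst_add snd_add)
  with P show S: "(\<lambda>(k, n). f n * g (k - n)) abs_summable_on UNIV" by simp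
  have S': "(\<lambda>(k, n). f n * g (k - n)) summable_on UNIV \<times> UNIV"
    using abs_summable_summable[OF S] by simp
  have P': "(\<lambda>(n, m). f n * g m) summable_on UNIV \<times> UNIV"
    using abs_summable_summable[OF P] by simp
  have "(\<Sum>\<^sub>\<infinity>k. \<Sum>\<^sub>\<infinity>n. f n * g (k - n)) = (\<Sum>\<^sub>\<infinity>(k, n). f n * g (k - n))"
    using infsum_Sigma'_banach[OF S'] by simp
  also have "\<dots> = (\<Sum>\<^sub>\<infinity>(n, m). f n * g m)"
    by (rule infsum_reindex_bij_witness[where i = "\<lambda>(n, m). (n + m, n)" and j = "\<lambda>(k, n). (n, k - n)"])
       (auto simp: split_def simp del: fst_add snd_add)
  also have "\<dots> = (\<Sum>\<^sub>\<infinity>n. \<Sum>\<^sub>\<infinity>m. f n * g m)"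
    using infsum_Sigma'_banach[OF P'] by simp
  also have "\<dots> = infsum f UNIV * infsum g UNIV"
    by (simp add: infsum_cmult_right' infsum_cmult_left')
  finally show "(\<Sum>\<^sub>\<infinity>k. \<Sum>\<^sub>\<infinity>n. f n * g (k - n)) = infsum f UNIV * infsum g UNIV" .
  show "(\<lambda>k. \<Sum>\<^sub>\<infinity>n. f n * g (k - n)) summable_on UNIV"
    using summable_on_Sigma_banach[OF S'] by simp
qed

definition conv :: "wiener \<Rightarrow> wiener \<Rightarrow> wiener"  (infixl "\<star>" 70) where
  "a \<star> b = series (\<lambda>k. \<Sum>\<^sub>\<infinity>n. coef a n * coef b (k - n))"

lemma coef_abs_summable: "(\<lambda>k. norm (coef a k)) summable_on UNIV"
  by (rule summable_on_comparison_test[OF coef_summable[of a]])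
     (auto simp: mult_le_cancel_right1 not_less)

lemma conv_terms_summable:
  "(\<lambda>n. norm (coef a n * coef b (k - n))) summable_on UNIV"
proof -
  have "(\<lambda>(k, n). norm (coef a n * coef b (k - n))) summable_on UNIV \<times> UNIV"
    using double_sum_convolution(1)[OF coef_abs_summable coef_abs_summable] by (simp add: split_def)
  then show ?thesis using summable_on_SigmaD1[where x = k and A = UNIV] by fastforce
qed

lemma coef_conv: "coef (a \<star> b) k = (\<Sum>\<^sub>\<infinity>n. coef a n * coef b (k - n))"
  and norm_conv_le: "norm (a \<star> b) \<le> norm a * norm b"
proof -
  let ?f = "\<lambda>n. wt n * cmod (coef a n)" and ?g = "\<lambda>n. wt n * cmod (coef b n)"
  have fg: "(\<lambda>n. norm (?f n)) summable_on UNIV" "(\<lambda>n. norm (?g n)) summable_on UNIV"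
    using coef_summable by (simp_all add: abs_mult)
  note D = double_sum_convolution[OF this]
  have Sk: "(\<lambda>n. ?f n * ?g (k - n)) summable_on UNIV" for k
  proof -
    have "(\<lambda>(k, n). ?f n * ?g (k - n)) summable_on UNIV \<times> UNIV"
      using D(1) by (simp add: split_def)
    then show ?thesis using summable_on_SigmaD1[where x = k and A = UNIV] by fastforce
  qed
  have le: "wt k * cmod (\<Sum>\<^sub>\<infinity>n. coef a n * coef b (k - n)) \<le> (\<Sum>\<^sub>\<infinity>n. ?f n * ?g (k - n))" for k
  proof -
    have "wt k * cmod (\<Sum>\<^sub>\<infinity>n. coef a n * coef b (k - n))
        \<le> wt k * (\<Sum>\<^sub>\<infinity>n. cmod (coef a n * coef b (k - n)))"
      by (intro mult_left_mono norm_infsum_bound conv_terms_summable) auto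
    also have "\<dots> = (\<Sum>\<^sub>\<infinity>n. wt k * cmod (coef a n * coef b (k - n)))"
      by (simp add: infsum_cmult_right')
    also have "\<dots> \<le> (\<Sum>\<^sub>\<infinity>n. ?f n * ?g (k - n))"
    proof (intro infsum_mono Sk)
      show "(\<lambda>n. wt k * cmod (coef a n * coef b (k - n))) summable_on UNIV"
        by (intro summable_on_cmult_right conv_terms_summable)
      fix n
      have "wt k \<le> wt n * wt (k - n)" using wt_submult[of n "k - n"] by (simp del: fst_diff snd_diff)
      then have "wt k * (cmod (coef a n) * cmod (coef b (k - n)))
          \<le> (wt n * wt (k - n)) * (cmod (coef a n) * cmod (coef b (k - n)))"
        by (intro mult_right_mono) auto
      then show "wt k * cmod (coef a n * coef b (k - n)) \<le> ?f n * ?g (k - n)"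
        by (simp add: norm_mult mult_ac)
    qed
    finally show ?thesis .
  qed
  have c: "coef (a \<star> b) = (\<lambda>k. \<Sum>\<^sub>\<infinity>n. coef a n * coef b (k - n))"
    unfolding conv_def by (rule series_dominated[OF D(3) le])
  then show "coef (a \<star> b) k = (\<Sum>\<^sub>\<infinity>n. coef a n * coef b (k - n))" by simp
  have "norm (a \<star> b) \<le> (\<Sum>\<^sub>\<infinity>k. \<Sum>\<^sub>\<infinity>n. ?f n * ?g (k - n))"
    unfolding norm_wiener_def by (intro infsum_mono coef_summable D(3)) (simp add: c le)
  also have "\<dots> = norm a * norm b" by (simp add: D(2) norm_wiener_def)
  finally show "norm (a \<star> b) \<le> norm a * norm b" .
qed

lemma conv_terms_summable': "(\<lambda>n. coef a n * coef b (k - n)) summable_on UNIV"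
  by (rule abs_summable_summable[OF conv_terms_summable])

lemma infsum_conv_diff:
  "(\<Sum>\<^sub>\<infinity>n. coef a n * coef b (k - n) - coef c n * coef d (k - n))
    = (\<Sum>\<^sub>\<infinity>n. coef a n * coef b (k - n)) - (\<Sum>\<^sub>\<infinity>n. coef c n * coef d (k - n))"
  using infsum_add[OF conv_terms_summable'[of a b k] summable_on_uminus[THEN iffD2, OF conv_terms_summable'[of c d k]]]
  by (simp add: infsum_uminus)

lemma conv_diff_left: "(a - b) \<star> c = a \<star> c - b \<star> c"
  by (rule wiener_eqI)
     (simp add: coef_conv left_diff_distrib infsum_conv_diff)

lemma conv_diff_right: "a \<star> (b - c) = a \<star> b - a \<star> c"
  by (rule wiener_eqI)
     (simp add: coef_conv right_diff_distrib infsum_conv_diff)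

lemma conv_scaleR_left: "(r *\<^sub>R a) \<star> b = r *\<^sub>R (a \<star> b)"
  by (rule wiener_eqI) (simp add: coef_conv infsum_scaleR_right)

lemma conv_scaleR_right: "a \<star> (r *\<^sub>R b) = r *\<^sub>R (a \<star> b)"
  by (rule wiener_eqI) (simp add: coef_conv infsum_scaleR_right)

text \<open>
  The power with exponent \<open>n + 1\<close>.
\<close>

primrec wpow :: "wiener \<Rightarrow> nat \<Rightarrow> wiener" where
  "wpow a 0 = a"
| "wpow a (Suc n) = a \<star> wpow a n"

lemma wpow_scaleR: "wpow (r *\<^sub>R a) n = r ^ Suc n *\<^sub>R wpow a n"
  by (induction n) (simp_all add: conv_scaleR_left conv_scaleR_right)

lemma norm_wpow_le: "norm (wpow a n) \<le> norm a ^ Suc n"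
proof (induction n)
  case (Suc n)
  have "norm (wpow a (Suc n)) \<le> norm a * norm (wpow a n)" by (simp add: norm_conv_le)
  also have "\<dots> \<le> norm a * norm a ^ Suc n" by (intro mult_left_mono Suc) auto
  finally show ?case by simp
qed simp

text \<open>
  Telescoping along the recursion, with the mean value theorem for \<open>x\<^sup>n\<^sup>+\<^sup>1\<close> as the model.
\<close>

lemma norm_wpow_diff_le:
  assumes "norm a \<le> B" "norm b \<le> B"
  shows "norm (wpow a n - wpow b n) \<le> real (Suc n) * B ^ n * norm (a - b)"
proof (induction n)
  case (Suc n)
  have B: "0 \<le> B" using assms(1) norm_ge_zero order_trans by blast
  have "wpow a (Suc n) - wpow b (Suc n) = (a - b) \<star> wpow a n + b \<star> (wpow a n - wpow b n)"
    by (simp add: conv_diff_left conv_diff_right)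
  then have "norm (wpow a (Suc n) - wpow b (Suc n))
      \<le> norm ((a - b) \<star> wpow a n) + norm (b \<star> (wpow a n - wpow b n))"
    by (metis norm_triangle_ineq)
  also have "\<dots> \<le> norm (a - b) * norm (wpow a n) + norm b * norm (wpow a n - wpow b n)"
    by (intro add_mono norm_conv_le)
  also have "\<dots> \<le> norm (a - b) * B ^ Suc n + B * (real (Suc n) * B ^ n * norm (a - b))"
    using assms B
    by (intro add_mono mult_mono Suc order_trans[OF norm_wpow_le] power_mono mult_nonneg_nonneg) auto
  also have "\<dots> = real (Suc (Suc n)) * B ^ Suc n * norm (a - b)" by (simp add: algebra_simps)
  finally show ?case .
qed simp

section \<open>Fourier series with rapidly decaying coefficients\<close>

definition bracket :: "int \<times> int \<Rightarrow> real" where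
  "bracket k = 1 + \<bar>of_int (fst k)\<bar> + \<bar>of_int (snd k)\<bar>"

definition rapid :: "(int \<times> int \<Rightarrow> complex) \<Rightarrow> bool" where
  "rapid a \<longleftrightarrow> (\<forall>N. (\<lambda>k. bracket k ^ N * cmod (a k)) summable_on UNIV)"

lemma bracket_ge_one [simp]: "bracket k \<ge> 1" and bracket_nonneg [simp]: "bracket k \<ge> 0"
  by (simp_all add: bracket_def)

text \<open>
  A single term of the exponential series, taken at \<open>bracket k\<close>, is at most the whole.
\<close>

lemma bracket_power_le_wt: "bracket k ^ N \<le> fact N * exp 1 * wt k"
proof -
  have *: "x ^ N \<le> fact N * exp x" if "x \<ge> 0" for x :: real
  proof -
    have "(\<Sum>n\<in>{N}. x ^ n /\<^sub>R fact n) \<le> exp x"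
      unfolding exp_def by (rule sum_le_suminf) (use that summable_exp_generic[of x] in \<open>auto simp: field_simps\<close>)
    then show ?thesis by (simp add: divide_simps mult_ac)
  qed
  have "exp (bracket k) = exp 1 * wt k"
    by (simp add: bracket_def wt_def flip: exp_add)
  with *[of "bracket k"] show ?thesis by (simp add: mult.assoc)
qed

lemma rapid_coef [simp]: "rapid (coef a)"
  unfolding rapid_def
proof
  fix N
  have "(\<lambda>k. (fact N * exp 1) * (wt k * cmod (coef a k))) summable_on UNIV"
    by (intro summable_on_cmult_right coef_summable)
  then show "(\<lambda>k. bracket k ^ N * cmod (coef a k)) summable_on UNIV"
  proof (rule summable_on_comparison_test)
    fix k
    show "bracket k ^ N * cmod (coef a k) \<le> (fact N * exp 1) * (wt k * cmod (coef a k))"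
      using mult_right_mono[OF bracket_power_le_wt[of k N], of "cmod (coef a k)"] by (simp add: mult_ac)
  qed auto
qed

lemma rapid_add: "rapid a \<Longrightarrow> rapid b \<Longrightarrow> rapid (\<lambda>k. a k + b k)"
  unfolding rapid_def
proof
  fix N
  assume "\<forall>N. (\<lambda>k. bracket k ^ N * cmod (a k)) summable_on UNIV" "\<forall>N. (\<lambda>k. bracket k ^ N * cmod (b k)) summable_on UNIV"
  then have "(\<lambda>k. bracket k ^ N * cmod (a k) + bracket k ^ N * cmod (b k)) summable_on UNIV"
    by (intro summable_on_add) blast+
  then show "(\<lambda>k. bracket k ^ N * cmod (a k + b k)) summable_on UNIV"
    by (rule summable_on_comparison_test)
       (auto simp: distrib_left[symmetric] intro!: mult_left_mono norm_triangle_ineq)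
qed

lemma rapid_mult:
  assumes "rapid a" and "\<And>k. cmod (f k) \<le> C * bracket k ^ N"
  shows "rapid (\<lambda>k. f k * a k)"
  unfolding rapid_def
proof
  fix M
  have "(\<lambda>k. C * (bracket k ^ (M + N) * cmod (a k))) summable_on UNIV"
    using assms(1) by (intro summable_on_cmult_right) (simp add: rapid_def)
  then show "(\<lambda>k. bracket k ^ M * cmod (f k * a k)) summable_on UNIV"
  proof (rule summable_on_comparison_test)
    fix k
    have "(bracket k ^ M * cmod (a k)) * cmod (f k) \<le> (bracket k ^ M * cmod (a k)) * (C * bracket k ^ N)"
      by (intro mult_left_mono assms) auto
    then show "bracket k ^ M * cmod (f k * a k) \<le> C * (bracket k ^ (M + N) * cmod (a k))"
      by (simp add: norm_mult power_add mult_ac)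
  qed auto
qed

lemma fst_le_bracket: "\<bar>of_int (fst k)\<bar> \<le> bracket k" and snd_le_bracket: "\<bar>of_int (snd k)\<bar> \<le> bracket k"
  by (simp_all add: bracket_def)

lemma rapid_fst: "rapid a \<Longrightarrow> rapid (\<lambda>k. (\<i> * of_real w * of_int (fst k)) * a k)"
  by (rule rapid_mult[where C = "\<bar>w\<bar>" and N = 1])
     (simp_all add: norm_mult mult_left_mono fst_le_bracket del: split_paired_All)

lemma rapid_snd: "rapid a \<Longrightarrow> rapid (\<lambda>k. (\<i> * of_int (snd k)) * a k)"
  by (rule rapid_mult[where C = 1 and N = 1]) (simp_all add: norm_mult snd_le_bracket)

lemma rapid_summable: "rapid a \<Longrightarrow> (\<lambda>k. cmod (a k)) summable_on UNIV"
  unfolding rapid_def by (erule allE[of _ 0]) simp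

definition mode :: "real \<Rightarrow> real \<Rightarrow> real \<Rightarrow> int \<times> int \<Rightarrow> complex" where
  "mode w t x k = cis (of_int (fst k) * w * t + of_int (snd k) * x)"

lemma norm_mode [simp]: "cmod (mode w t x k) = 1"
  by (simp add: mode_def)

lemma mode_add: "mode w t x (n + k) = mode w t x n * mode w t x k"
  by (simp add: mode_def cis_mult algebra_simps)

definition evc :: "real \<Rightarrow> (int \<times> int \<Rightarrow> complex) \<Rightarrow> real \<Rightarrow> real \<Rightarrow> complex" where
  "evc w a t x = (\<Sum>\<^sub>\<infinity>k. a k * mode w t x k)"

definition ev :: "real \<Rightarrow> (int \<times> int \<Rightarrow> complex) \<Rightarrow> real \<Rightarrow> real \<Rightarrow> real" where
  "ev w a t x = Re (evc w a t x)"

lemma evc_summable: "rapid a \<Longrightarrow> (\<lambda>k. a k * mode w t x k) summable_on UNIV"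
  using rapid_summable[of a] by (intro Infinite_Sum.abs_summable_summable[of "\<lambda>k. a k * mode w t x k"]) (simp add: norm_mult)

lemma ev_rescale: "ev 1 a (w * t) x = ev w a t x"
  by (simp add: ev_def evc_def mode_def mult_ac)

lemma ev_add: "rapid a \<Longrightarrow> rapid b \<Longrightarrow> ev w (\<lambda>k. a k + b k) t x = ev w a t x + ev w b t x"
  by (simp add: ev_def evc_def distrib_right infsum_add evc_summable)

lemma ev_cmult: "ev w (\<lambda>k. complex_of_real r * a k) t x = r * ev w a t x"
  by (simp add: ev_def evc_def mult.assoc infsum_cmult_right')

lemma evc_conv: "evc w (coef (a \<star> b)) t x = evc w (coef a) t x * evc w (coef b) t x"
proof -
  let ?f = "\<lambda>k. coef a k * mode w t x k" and ?g = "\<lambda>k. coef b k * mode w t x k"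
  have "(\<lambda>k. norm (?f k)) summable_on UNIV" "(\<lambda>k. norm (?g k)) summable_on UNIV"
    using coef_abs_summable by (simp_all add: norm_mult)
  from double_sum_convolution(2)[OF this]
  have "evc w (coef a) t x * evc w (coef b) t x = (\<Sum>\<^sub>\<infinity>k. \<Sum>\<^sub>\<infinity>n. ?f n * ?g (k - n))"
    by (simp add: evc_def)
  also have "\<dots> = (\<Sum>\<^sub>\<infinity>k. \<Sum>\<^sub>\<infinity>n. (coef a n * coef b (k - n)) * mode w t x k)"
  proof (intro infsum_cong)
    fix k n
    have "mode w t x k = mode w t x n * mode w t x (k - n)"
      by (simp add: mode_add[symmetric] del: fst_diff snd_diff)
    then show "?f n * ?g (k - n) = (coef a n * coef b (k - n)) * mode w t x k" by simp
  qed
  also have "\<dots> = evc w (coef (a \<star> b)) t x"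
    by (simp add: infsum_cmult_left' evc_def coef_conv)
  finally show ?thesis by simp
qed

lemma evc_wpow: "evc w (coef (wpow a n)) t x = evc w (coef a) t x ^ Suc n"
  by (induction n) (simp_all add: evc_conv)

subsection \<open>Regularity\<close>

lemma uniform_limit_evc:
  assumes "rapid a"
  shows "uniform_limit Y (\<lambda>S y. \<Sum>k\<in>S. a k * mode w (fst y) (snd y) k)
           (\<lambda>y. evc w a (fst y) (snd y)) (finite_subsets_at_top UNIV)"
  unfolding evc_def
  by (rule Weierstrass_m_test_general[where M = "\<lambda>k. cmod (a k)"])
     (use rapid_summable[OF assms] in \<open>auto simp: norm_mult\<close>)

lemma continuous_on_mode: "continuous_on Y (\<lambda>y. mode w (fst y) (snd y) k)"
  unfolding mode_def cis_conv_exp by (intro continuous_intros)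

lemma continuous_on_evc:
  assumes "rapid a"
  shows "continuous_on Y (\<lambda>y. evc w a (fst y) (snd y))"
  by (rule uniform_limit_theorem[OF _ uniform_limit_evc[OF assms]])
     (auto intro!: always_eventually continuous_intros continuous_on_mode)

lemma DERIV_from_quadratic_remainder:
  fixes f :: "real \<Rightarrow> real"
  assumes "\<And>h. \<bar>f (t + h) - f t - h * D\<bar> \<le> K * h\<^sup>2"
  shows "(f has_real_derivative D) (at t)"
  unfolding DERIV_def
proof (rule LIM_zero_cancel, rule Lim_null_comparison)
  show "\<forall>\<^sub>F h in at 0. norm ((f (t + h) - f t) / h - D) \<le> K * \<bar>h\<bar>"
    unfolding eventually_at
  proof (intro exI[of _ 1] conjI ballI impI)
    fix h :: real assume "h \<noteq> 0 \<and> dist h 0 < 1"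
    then have h: "h \<noteq> 0" by simp
    then have "(f (t + h) - f t) / h - D = (f (t + h) - f t - h * D) / h" by (simp add: field_simps)
    then have "norm ((f (t + h) - f t) / h - D) = \<bar>f (t + h) - f t - h * D\<bar> / \<bar>h\<bar>" by (simp add: abs_divide)
    also have "\<dots> \<le> K * h\<^sup>2 / \<bar>h\<bar>" by (intro divide_right_mono assms) auto
    also have "\<dots> = K * \<bar>h\<bar>" using h by (simp add: power2_eq_square abs_if)
    finally show "norm ((f (t + h) - f t) / h - D) \<le> K * \<bar>h\<bar>" .
  qed simp
  show "((\<lambda>h. K * \<bar>h\<bar>) \<longlongrightarrow> 0) (at 0)" by (auto intro!: tendsto_eq_intros)
qed

lemma cis_taylor: "cmod (cis (y + h) - cis y - \<i> * of_real h * cis y) \<le> h\<^sup>2"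
proof -
  have "cmod (exp (\<i> * of_real h) - (\<Sum>k\<le>1. (\<i> * of_real h) ^ k / fact k)) \<le> exp \<bar>Re (\<i> * of_real h)\<bar> * cmod (\<i> * of_real h) ^ Suc 1 / fact 1"
    by (rule Taylor_exp)
  then have *: "cmod (cis h - 1 - \<i> * of_real h) \<le> h\<^sup>2"
    by (simp add: cis_conv_exp norm_mult power2_eq_square algebra_simps)
  have "cis (y + h) - cis y - \<i> * of_real h * cis y = cis y * (cis h - 1 - \<i> * of_real h)"
    by (simp add: cis_mult[symmetric] algebra_simps)
  then show ?thesis using * by (simp add: norm_mult)
qed

text \<open>
  Termwise differentiation along a line on which the phase of mode \<open>k\<close> grows at speed \<open>s k\<close>: the first order
  Taylor remainder of each mode is at most \<open>(s k h)\<^sup>2\<close>, and these bounds can be summed. Time and space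
  derivatives are the cases \<open>s k = w l\<close> and \<open>s k = j\<close>.
\<close>

lemma ev_increment:
  assumes a: "rapid a" and b: "rapid (\<lambda>k. \<i> * of_real (s k) * a k)"
    and c: "(\<lambda>k. (s k)\<^sup>2 * cmod (a k)) summable_on UNIV"
    and m: "\<And>k. mode w t' x' k = cis (of_int (fst k) * w * t + of_int (snd k) * x + s k * h)"
  shows "\<bar>ev w a t' x' - ev w a t x - h * ev w (\<lambda>k. \<i> * of_real (s k) * a k) t x\<bar>
     \<le> (\<Sum>\<^sub>\<infinity>k. (s k)\<^sup>2 * cmod (a k)) * h\<^sup>2"
proof -
  let ?b = "\<lambda>k. \<i> * of_real (s k) * a k"
  have S: "((\<lambda>k. a k * mode w t' x' k - a k * mode w t x k - of_real h * (?b k * mode w t x k)) has_sum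
      (evc w a t' x' - evc w a t x - of_real h * evc w ?b t x)) UNIV"
    unfolding evc_def diff_conv_add_uminus
    by (intro has_sum_add has_sum_uminusI has_sum_cmult_right has_sum_infsum evc_summable a b)
  have "cmod (evc w a t' x' - evc w a t x - of_real h * evc w ?b t x) \<le> (\<Sum>\<^sub>\<infinity>k. (s k)\<^sup>2 * cmod (a k)) * h\<^sup>2"
  proof (rule norm_infsum_le[OF S])
    show "((\<lambda>k. (s k)\<^sup>2 * cmod (a k) * h\<^sup>2) has_sum (\<Sum>\<^sub>\<infinity>k. (s k)\<^sup>2 * cmod (a k)) * h\<^sup>2) UNIV"
      by (intro has_sum_cmult_left has_sum_infsum c)
    fix k
    let ?y = "of_int (fst k) * w * t + of_int (snd k) * x"
    have "a k * mode w t' x' k - a k * mode w t x k - of_real h * (?b k * mode w t x k)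
      = a k * (cis (?y + s k * h) - cis ?y - \<i> * of_real (s k * h) * cis ?y)"
      unfolding m by (simp add: mode_def algebra_simps)
    then show "cmod (a k * mode w t' x' k - a k * mode w t x k - of_real h * (?b k * mode w t x k))
        \<le> (s k)\<^sup>2 * cmod (a k) * h\<^sup>2"
      using mult_left_mono[OF cis_taylor[of ?y "s k * h"], of "cmod (a k)"]
      by (simp add: norm_mult power_mult_distrib mult_ac)
  qed
  then show ?thesis
    using abs_Re_le_cmod[of "evc w a t' x' - evc w a t x - of_real h * evc w ?b t x"]
    by (simp add: ev_def)
qed

lemma rapid_square_summable:
  assumes "rapid a" "\<And>k. \<bar>s k\<bar> \<le> C * bracket k" 
  shows "(\<lambda>k. (s k)\<^sup>2 * cmod (a k)) summable_on UNIV"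
proof -
  have "(\<lambda>k. C\<^sup>2 * (bracket k ^ 2 * cmod (a k))) summable_on UNIV"
    using assms(1) unfolding rapid_def by (intro summable_on_cmult_right) blast
  then show ?thesis
  proof (rule summable_on_comparison_test)
    fix k
    have "(s k)\<^sup>2 \<le> (C * bracket k)\<^sup>2" using assms(2)[of k] abs_le_square_iff by fastforce
    from mult_right_mono[OF this, of "cmod (a k)"]
    show "(s k)\<^sup>2 * cmod (a k) \<le> C\<^sup>2 * (bracket k ^ 2 * cmod (a k))"
      by (simp add: power_mult_distrib mult_ac)
  qed auto
qed

lemma has_dt_ev:
  assumes a: "rapid a"
  shows "has_dt (ev w a) (ev w (\<lambda>k. (\<i> * of_real w * of_int (fst k)) * a k))"
  unfolding has_dt_def
proof (intro allI DERIV_from_quadratic_remainder)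
  fix t x h
  have le: "\<bar>w * of_int (fst k)\<bar> \<le> \<bar>w\<bar> * bracket k" for k
    by (simp add: abs_mult mult_left_mono fst_le_bracket)
  have "rapid (\<lambda>k. \<i> * of_real (w * of_int (fst k)) * a k)"
    using rapid_fst[OF a, of w] by (simp add: mult.assoc)
  from ev_increment[OF a this rapid_square_summable[OF a le], where t' = "t + h" and x' = x and t = t and x = x and h = h and w = w]
  show "\<bar>ev w a (t + h) x - ev w a t x - h * ev w (\<lambda>k. (\<i> * of_real w * of_int (fst k)) * a k) t x\<bar>
     \<le> (\<Sum>\<^sub>\<infinity>k. (w * of_int (fst k))\<^sup>2 * cmod (a k)) * h\<^sup>2"
    by (simp add: mode_def algebra_simps)
qed

lemma has_dx_ev:
  assumes a: "rapid a"
  shows "has_dx (ev w a) (ev w (\<lambda>k. (\<i> * of_int (snd k)) * a k))"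
  unfolding has_dx_def
proof (intro allI DERIV_from_quadratic_remainder)
  fix t x h
  have le: "\<bar>of_int (snd k) :: real\<bar> \<le> 1 * bracket k" for k
    by (simp add: snd_le_bracket)
  have "rapid (\<lambda>k. \<i> * of_real (of_int (snd k)) * a k)"
    using rapid_snd[OF a] by simp
  from ev_increment[OF a this rapid_square_summable[OF a le], where t' = t and x' = "x + h" and t = t and x = x and h = h and w = w]
  show "\<bar>ev w a t (x + h) - ev w a t x - h * ev w (\<lambda>k. (\<i> * of_int (snd k)) * a k) t x\<bar>
     \<le> (\<Sum>\<^sub>\<infinity>k. (of_int (snd k))\<^sup>2 * cmod (a k)) * h\<^sup>2"
    by (simp add: mode_def algebra_simps)
qed

lemma C_class_ev: "rapid a \<Longrightarrow> C_class n (ev w a)"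
proof (induction n arbitrary: a)
  case 0
  have "continuous_on UNIV (\<lambda>y. Re (evc w a (fst y) (snd y)))"
    by (intro continuous_intros continuous_on_evc 0)
  then show ?case by (simp add: ev_def split_def)
next
  case (Suc n)
  then show ?case
    using has_dt_ev[OF Suc.prems, of w] has_dx_ev[OF Suc.prems, of w]
      Suc.IH[OF rapid_fst[OF Suc.prems, of w]] Suc.IH[OF rapid_snd[OF Suc.prems]]
    unfolding C_class.simps by blast
qed

subsection \<open>Symmetries\<close>

text \<open>
  The coefficients of real-valued functions.
\<close>

definition herm :: "(int \<times> int \<Rightarrow> complex) \<Rightarrow> bool" where
  "herm a \<longleftrightarrow> (\<forall>k. a (- k) = cnj (a k))"

lemma bij_uminus_int2: "bij (uminus :: int \<times> int \<Rightarrow> int \<times> int)"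
  by (rule o_bij[of uminus]) auto

lemma evc_real:
  assumes "herm a"
  shows "evc w a t x = of_real (ev w a t x)"
proof -
  have "cnj (evc w a t x) = (\<Sum>\<^sub>\<infinity>k. cnj (a k) * cnj (mode w t x k))"
    unfolding evc_def infsum_cnj[symmetric] by simp
  also have "\<dots> = (\<Sum>\<^sub>\<infinity>k. a (- k) * mode w t x (- k))"
    using assms
    by (intro infsum_cong) (simp add: herm_def mode_def cis_cnj algebra_simps del: split_paired_All)
  also have "\<dots> = evc w a t x"
    unfolding evc_def by (rule infsum_reindex_bij_betw[OF bij_uminus_int2])
  finally show ?thesis by (simp add: ev_def complex_eq_iff)
qed

definition xflip :: "int \<times> int \<Rightarrow> int \<times> int" where
  "xflip k = (fst k, - snd k)"

lemma xflip_xflip [simp]: "xflip (xflip k) = k"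
  and xflip_diff: "xflip (n - k) = xflip n - xflip k"
  by (simp_all add: xflip_def prod_eq_iff)

lemma bij_xflip: "bij xflip"
  by (rule o_bij[of xflip]) auto

text \<open>
  The factor \<open>r\<close> is the parity under \<open>x \<mapsto> - x\<close>: sine series have \<open>r = - 1\<close>, and parities multiply under
  convolution.
\<close>

definition xsym :: "real \<Rightarrow> (int \<times> int \<Rightarrow> complex) \<Rightarrow> bool" where
  "xsym r a \<longleftrightarrow> (\<forall>k. a (xflip k) = of_real r * a k)"

lemma ev_odd:
  assumes "xsym (- 1) a"
  shows "ev w a t (- x) = - ev w a t x"
proof -
  have "evc w a t x = (\<Sum>\<^sub>\<infinity>k. a (xflip k) * mode w t x (xflip k))"
    unfolding evc_def by (rule infsum_reindex_bij_betw[OF bij_xflip, symmetric])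
  also have "\<dots> = (\<Sum>\<^sub>\<infinity>k. - (a k * mode w t (- x) k))"
    using assms by (intro infsum_cong) (simp add: xsym_def mode_def xflip_def)
  also have "\<dots> = - evc w a t (- x)" by (simp add: infsum_uminus evc_def)
  finally show ?thesis by (simp add: ev_def)
qed

lemma cis_plus_int_2pi: "cis (y + of_int n * (2 * pi)) = cis y"
  using cis_multiple_2pi[of "of_int n"] by (simp add: cis_mult[symmetric] mult_ac)

lemma periodic_x_ev: "periodic_x (2 * pi) (ev w a)"
proof -
  have "mode w t (x + 2 * pi) k = mode w t x k" for t x k
    using cis_plus_int_2pi[of "of_int (fst k) * w * t + of_int (snd k) * x" "snd k"]
    by (simp add: mode_def algebra_simps)
  then show ?thesis by (simp add: periodic_x_def ev_def evc_def)
qed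

lemma periodic_t_ev:
  assumes "w \<noteq> 0"
  shows "periodic_t (2 * pi / w) (ev w a)"
proof -
  have "mode w (t + 2 * pi / w) x k = mode w t x k" for t x k
    using cis_plus_int_2pi[of "of_int (fst k) * w * t + of_int (snd k) * x" "fst k"] assms
    by (simp add: mode_def algebra_simps)
  then show ?thesis by (simp add: periodic_t_def ev_def evc_def)
qed

text \<open>
  An odd \<open>2\<pi>\<close>-periodic function vanishes at both ends of \<open>[0, \<pi>]\<close>.
\<close>

lemma ev_dirichlet:
  assumes "xsym (- 1) a"
  shows "ev w a t 0 = 0" "ev w a t pi = 0"
proof -
  show "ev w a t 0 = 0" using ev_odd[OF assms, of w t 0] by simp
  have "ev w a t pi = ev w a t (- pi)"
    using periodic_x_ev[of w a] unfolding periodic_x_def by (metis add.commute add_diff_cancel_left' diff_conv_add_uminus mult_2)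
  then show "ev w a t pi = 0" using ev_odd[OF assms, of w t pi] by simp
qed

lemma herm_conv:
  assumes "herm (coef a)" "herm (coef b)"
  shows "herm (coef (a \<star> b))"
  unfolding herm_def
proof
  fix k
  have "coef (a \<star> b) (- k) = (\<Sum>\<^sub>\<infinity>n. coef a (- n) * coef b (- k - (- n)))"
    unfolding coef_conv by (rule infsum_reindex_bij_betw[OF bij_uminus_int2, symmetric])
  also have "\<dots> = (\<Sum>\<^sub>\<infinity>n. cnj (coef a n * coef b (k - n)))"
  proof (intro infsum_cong)
    fix n
    have "- k - (- n) = - (k - n)" by simp
    then show "coef a (- n) * coef b (- k - (- n)) = cnj (coef a n * coef b (k - n))"
      using assms unfolding herm_def by (metis complex_cnj_mult)
  qed
  finally show "coef (a \<star> b) (- k) = cnj (coef (a \<star> b) k)" by (simp only: infsum_cnj coef_conv)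
qed

lemma xsym_conv:
  assumes "xsym r (coef a)" "xsym s (coef b)"
  shows "xsym (r * s) (coef (a \<star> b))"
  unfolding xsym_def
proof
  fix k
  have "coef (a \<star> b) (xflip k) = (\<Sum>\<^sub>\<infinity>n. coef a (xflip n) * coef b (xflip k - xflip n))"
    unfolding coef_conv by (rule infsum_reindex_bij_betw[OF bij_xflip, symmetric])
  also have "\<dots> = (\<Sum>\<^sub>\<infinity>n. of_real (r * s) * (coef a n * coef b (k - n)))"
    using assms by (intro infsum_cong) (simp add: xsym_def xflip_diff[symmetric] del: split_paired_All)
  finally show "coef (a \<star> b) (xflip k) = of_real (r * s) * coef (a \<star> b) k"
    by (simp only: infsum_cmult_right' coef_conv)
qed

lemma herm_wpow: "herm (coef a) \<Longrightarrow> herm (coef (wpow a n))"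
  by (induction n) (simp_all add: herm_conv)

lemma xsym_wpow: "xsym r (coef a) \<Longrightarrow> xsym (r ^ Suc n) (coef (wpow a n))"
proof (induction n)
  case (Suc n)
  then have "xsym (r * r ^ Suc n) (coef (a \<star> wpow a n))" by (intro xsym_conv)
  then show ?case by simp
qed simp

subsection \<open>Fourier coefficients and Sobolev norms\<close>

lemma has_integral_cis_period:
  "((\<lambda>t. cis (of_int n * t)) has_integral (if n = 0 then 2 * of_real pi else 0)) {0..2 * pi}"
proof (cases "n = 0")
  case True
  have "((\<lambda>t::real. 1 :: complex) has_integral (2 * pi - 0) *\<^sub>R 1) (cbox 0 (2 * pi))"
    using has_integral_const[of "1::complex" 0 "2 * pi"] by simp
  then show ?thesis using True by (simp add: scaleR_conv_of_real)
next
  case False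
  have "((\<lambda>t. cis (of_int n * t)) has_integral
      (cis (of_int n * (2 * pi)) / (\<i> * of_int n) - cis (of_int n * 0) / (\<i> * of_int n))) {0..2 * pi}"
  proof (rule fundamental_theorem_of_calculus)
    fix t
    have "((\<lambda>t. exp (\<i> * of_int n * t) / (\<i> * of_int n)) has_field_derivative exp (\<i> * of_int n * of_real t)) (at (of_real t))"
      using False by (auto intro!: derivative_eq_intros)
    from has_vector_derivative_real_field[OF this]
    have "((\<lambda>t. exp (\<i> * of_int n * of_real t) / (\<i> * of_int n)) has_vector_derivative exp (\<i> * of_int n * of_real t)) (at t within {0..2 * pi})"
      by (simp add: has_vector_derivative_at_within)
    then show "((\<lambda>t. cis (of_int n * t) / (\<i> * of_int n)) has_vector_derivative cis (of_int n * t)) (at t within {0..2 * pi})"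
      by (simp add: cis_conv_exp mult_ac)
  qed simp
  then show ?thesis using False cis_plus_int_2pi[of 0 n] by simp
qed

lemma integral_mode:
  "integral torus_box (\<lambda>y. mode 1 (fst y) (snd y) k) = (if k = 0 then of_real ((2 * pi)\<^sup>2) else 0)"
proof -
  have i: "integral (cbox 0 (2 * pi)) (\<lambda>t. cis (of_int n * t)) = (if n = 0 then 2 * of_real pi else 0)" for n :: int
    using integral_unique[OF has_integral_cis_period[of n]] by simp
  have "integral torus_box (\<lambda>y. mode 1 (fst y) (snd y) k)
     = integral (cbox 0 (2 * pi)) (\<lambda>t. integral (cbox 0 (2 * pi)) (\<lambda>x. mode 1 t x k))"
    unfolding torus_box_def by (subst integral_prod_continuous) (auto intro: continuous_on_mode)
  also have "\<dots> = integral (cbox 0 (2 * pi)) (\<lambda>t. cis (of_int (fst k) * t) * (if snd k = 0 then 2 * of_real pi else 0))"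
    by (simp add: mode_def cis_mult[symmetric] i del: box_real)
  also have "\<dots> = (if fst k = 0 then 2 * of_real pi else 0) * (if snd k = 0 then 2 * of_real pi else 0)"
    by (simp add: i del: box_real)
  finally show ?thesis by (auto simp: prod_eq_iff power2_eq_square)
qed

text \<open>
  The series converges uniformly, so it may be integrated term by term; after division by the mode
  \<open>(l, j)\<close> a single term has a nonzero integral.
\<close>

lemma fourier_coeff_ev:
  assumes a: "rapid a" and h: "herm a"
  shows "fourier_coeff (ev 1 a) l j = a (l, j)"
proof -
  define b where "b = (\<lambda>k. a (k + (l, j)))"
  let ?f = "\<lambda>y. complex_of_real (ev 1 a (fst y) (snd y)) * cis (- (of_int l * fst y + of_int j * snd y))"
  let ?s = "\<lambda>S y. (\<Sum>k\<in>S. a k * mode 1 (fst y) (snd y) k) * cis (- (of_int l * fst y + of_int j * snd y))"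
  have s: "?s S y = (\<Sum>k\<in>S. a k * mode 1 (fst y) (snd y) (k - (l, j)))" for S y
  proof -
    have "mode 1 (fst y) (snd y) k * cis (- (of_int l * fst y + of_int j * snd y))
        = mode 1 (fst y) (snd y) (k - (l, j))" for k
      by (simp add: mode_def cis_mult algebra_simps)
    then show ?thesis by (simp only: sum_distrib_right mult.assoc)
  qed
  have c: "continuous_on torus_box ?f"
    unfolding evc_real[OF h, symmetric] cis_conv_exp
    by (intro continuous_intros continuous_on_evc a)
  have cs: "continuous_on torus_box (?s S)" for S
    unfolding s by (intro continuous_intros continuous_on_mode)
  have u: "uniform_limit torus_box ?s ?f (finite_subsets_at_top UNIV)"
  proof (rule uniform_limitI)
    fix e :: real assume "e > 0"
    from uniform_limitD[OF uniform_limit_evc[OF a, where Y = torus_box and w = 1] this]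
    show "\<forall>\<^sub>F S in finite_subsets_at_top UNIV. \<forall>y\<in>torus_box. dist (?s S y) (?f y) < e"
      by eventually_elim
         (simp add: dist_norm evc_real[OF h] norm_mult flip: left_diff_distrib)
  qed
  obtain I J where I: "\<And>S. (?s S has_integral I S) torus_box" and J: "(?f has_integral J) torus_box"
    and IJ: "(I \<longlongrightarrow> J) (finite_subsets_at_top UNIV)"
    using uniform_limit_integral_cbox[OF u[unfolded torus_box_def] cs[unfolded torus_box_def]]
    unfolding torus_box_def[symmetric] by auto
  have "I S = a (l, j) * of_real ((2 * pi)\<^sup>2)" if "finite S" "(l, j) \<in> S" for S
  proof -
    have "I S = integral torus_box (\<lambda>y. \<Sum>k\<in>S. a k * mode 1 (fst y) (snd y) (k - (l, j)))"
      using integral_unique[OF I[of S]] unfolding s by simp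
    also have "\<dots> = (\<Sum>k\<in>S. integral torus_box (\<lambda>y. a k * mode 1 (fst y) (snd y) (k - (l, j))))"
      unfolding torus_box_def using that
      by (intro integral_sum integrable_continuous continuous_intros continuous_on_mode) auto
    also have "\<dots> = (\<Sum>k\<in>S. if k = (l, j) then a (l, j) * of_real ((2 * pi)\<^sup>2) else 0)"
      by (intro sum.cong refl) (simp add: integral_mode)
    finally show ?thesis using that by simp
  qed
  then have "\<forall>\<^sub>F S in finite_subsets_at_top UNIV. I S = a (l, j) * of_real ((2 * pi)\<^sup>2)"
    unfolding eventually_finite_subsets_at_top by (intro exI[of _ "{(l, j)}"]) auto
  then have "J = a (l, j) * of_real ((2 * pi)\<^sup>2)"
    using tendsto_unique[OF finite_subsets_at_top_neq_bot IJ] tendsto_eventually by metis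
  moreover have "(LINT y | lebesgue_on torus_box. ?f y) = integral torus_box ?f"
    using c unfolding torus_box_def by (intro lebesgue_integral_eq_integral continuous_imp_integrable) auto
  ultimately show ?thesis
    using integral_unique[OF J] by (simp add: fourier_coeff_def split_def)
qed

lemma sobolev_weight_le:
  assumes h: "herm (coef a)"
  shows "sobolev_weight (real N) (ev 1 (coef a)) k \<le> (fact N * exp 1 * (wt k * cmod (coef a k)))\<^sup>2"
proof -
  obtain l j where k: "k = (l, j)" by (cases k)
  have "1 + (of_int l)\<^sup>2 + (of_int j)\<^sup>2 \<le> (bracket k)\<^sup>2"
    by (simp add: bracket_def k power2_eq_square algebra_simps)
  then have "(1 + (of_int l)\<^sup>2 + (of_int j)\<^sup>2) powr real N \<le> (bracket k)\<^sup>2 ^ N"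
    by (subst powr_realpow) (auto intro!: power_mono add_pos_nonneg)
  also have "\<dots> = (bracket k ^ N)\<^sup>2" by (simp add: power_mult[symmetric] mult.commute)
  also have "\<dots> \<le> (fact N * exp 1 * wt k)\<^sup>2" by (intro power_mono bracket_power_le_wt) auto
  finally have "(1 + (of_int l)\<^sup>2 + (of_int j)\<^sup>2) powr real N * (cmod (coef a k))\<^sup>2
      \<le> (fact N * exp 1 * wt k)\<^sup>2 * (cmod (coef a k))\<^sup>2" by (intro mult_right_mono) auto
  then show ?thesis
    by (simp add: sobolev_weight_def k fourier_coeff_ev[OF rapid_coef h] power_mult_distrib)
qed

text \<open>
  The Sobolev norm is a weighted \<open>\<ell>\<^sup>2\<close> norm of the coefficients, which the weighted \<open>\<ell>\<^sup>1\<close> norm dominates.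
\<close>

lemma
  assumes h: "herm (coef a)"
  shows in_sobolev_ev: "in_sobolev (real N) (ev 1 (coef a))"
    and sobolev_norm_ev_le: "sobolev_norm (real N) (ev 1 (coef a)) \<le> fact N * exp 1 * norm a"
proof -
  let ?K = "fact N * exp 1 :: real"
  have K: "?K > 0" by simp
  have nn: "sobolev_weight (real N) (ev 1 (coef a)) k \<ge> 0" for k
    by (cases k) (simp add: sobolev_weight_def)
  have bnd: "(\<Sum>k\<in>S. sobolev_weight (real N) (ev 1 (coef a)) k) \<le> (?K * norm a)\<^sup>2" if "finite S" for S
  proof -
    have "(\<Sum>k\<in>S. sobolev_weight (real N) (ev 1 (coef a)) k) \<le> (\<Sum>k\<in>S. (?K * (wt k * cmod (coef a k)))\<^sup>2)"
      by (intro sum_mono sobolev_weight_le h)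
    also have "\<dots> \<le> (\<Sum>k\<in>S. (?K * (wt k * cmod (coef a k))) * (?K * norm a))"
      unfolding power2_eq_square
      by (intro sum_mono mult_left_mono norm_coef_le) auto
    also have "\<dots> = (?K * (\<Sum>k\<in>S. wt k * cmod (coef a k))) * (?K * norm a)"
      by (simp add: sum_distrib_left sum_distrib_right)
    also have "\<dots> \<le> (?K * norm a) * (?K * norm a)"
      by (intro mult_right_mono mult_left_mono sum_le_norm_wiener that) auto
    finally show ?thesis by (simp add: power2_eq_square)
  qed
  have S: "sobolev_weight (real N) (ev 1 (coef a)) summable_on UNIV"
    by (rule nonneg_bdd_above_summable_on) (auto intro!: bdd_aboveI2 bnd nn)
  have c: "continuous_on torus_box (\<lambda>y. ev 1 (coef a) (fst y) (snd y))"
    unfolding ev_def by (intro continuous_intros continuous_on_evc rapid_coef)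
  have "periodic_t (2 * pi) (ev 1 (coef a))" using periodic_t_ev[of 1] by simp
  moreover have "(\<lambda>(t, x). ev 1 (coef a) t x) \<in> borel_measurable (lebesgue_on torus_box)"
    unfolding split_def by (rule continuous_imp_measurable_on_sets_lebesgue[OF c]) (simp add: torus_box_def)
  moreover have "integrable (lebesgue_on torus_box) (\<lambda>(t, x). (ev 1 (coef a) t x)\<^sup>2)"
    unfolding split_def torus_box_def
    by (rule continuous_imp_integrable) (intro continuous_intros c[unfolded torus_box_def])
  ultimately show "in_sobolev (real N) (ev 1 (coef a))"
    using S periodic_x_ev by (simp add: in_sobolev_def)
  have "infsum (sobolev_weight (real N) (ev 1 (coef a))) UNIV \<le> (?K * norm a)\<^sup>2"
    by (rule infsum_le_finite_sums[OF S]) (use bnd in auto)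
  then show "sobolev_norm (real N) (ev 1 (coef a)) \<le> ?K * norm a"
    unfolding sobolev_norm_def by (intro real_le_lsqrt mult_nonneg_nonneg) auto
qed

section \<open>Small divisors\<close>

text \<open>
  The positive root of \<open>w\<^sup>2 - 4 h w - (1 + m) = 0\<close>, which is the real part of the resonant equation.
\<close>

definition freq :: "real \<Rightarrow> real \<Rightarrow> real" where
  "freq m h = 2 * h + sqrt (4 * h\<^sup>2 + 1 + m)"

lemma freq_zero: "freq m 0 = sqrt (1 + m)"
  by (simp add: freq_def)

lemma
  assumes "m > 0"
  shows freq_pos: "freq m h > 0"
    and freq_eq: "(1 + m) / freq m h - freq m h = - 4 * h"
proof -
  have "\<bar>2 * h\<bar> = sqrt ((2 * h)\<^sup>2)" by (rule real_sqrt_abs[symmetric])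
  also have "\<dots> < sqrt (4 * h\<^sup>2 + 1 + m)"
    using assms by (intro real_sqrt_less_mono) (simp add: power_mult_distrib)
  finally show pos: "freq m h > 0" by (simp add: freq_def)
  have "(sqrt (4 * h\<^sup>2 + 1 + m))\<^sup>2 = 4 * h\<^sup>2 + 1 + m"
    using assms by (intro real_sqrt_pow2) (auto intro!: add_nonneg_nonneg)
  then have "freq m h * freq m h = 4 * h * freq m h + (1 + m)"
    unfolding freq_def by (simp add: power2_eq_square algebra_simps)
  then show "(1 + m) / freq m h - freq m h = - 4 * h"
    using pos by (simp add: field_simps)
qed

text \<open>
  The function \<open>w - (1 + m)/w\<close>, which sends the frequency to \<open>4 h\<close>, has slope at least one.
\<close>

lemma freq_lipschitz:
  assumes "m > 0"
  shows "\<bar>freq m h - freq m h'\<bar> \<le> 4 * \<bar>h - h'\<bar>"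
proof -
  let ?a = "freq m h" and ?b = "freq m h'"
  have pos: "?a > 0" "?b > 0" using freq_pos[OF assms] by auto
  have "(?a - ?b) * (1 + (1 + m) / (?a * ?b)) = (?a - (1 + m) / ?a) - (?b - (1 + m) / ?b)"
    using pos by (simp add: field_simps)
  also have "\<dots> = 4 * (h - h')" using freq_eq[OF assms, of h] freq_eq[OF assms, of h'] by simp
  finally have "\<bar>?a - ?b\<bar> * \<bar>1 + (1 + m) / (?a * ?b)\<bar> = 4 * \<bar>h - h'\<bar>"
    by (metis abs_mult abs_numeral)
  moreover have "\<bar>?a - ?b\<bar> * 1 \<le> \<bar>?a - ?b\<bar> * \<bar>1 + (1 + m) / (?a * ?b)\<bar>"
    using pos assms by (intro mult_left_mono) auto
  ultimately show ?thesis by simp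
qed

text \<open>
  The operator \<open>\<partial>\<^sub>t\<^sup>2 - \<partial>\<^sub>x\<^sup>2 - \<alpha> \<partial>\<^sub>t\<partial>\<^sub>x\<^sup>2 + m\<close> multiplies the mode \<open>exp(i(l w t + j x))\<close> by \<open>w\<close> times the divisor below.
  The factor \<open>w\<close> is split off so that the resonant equation becomes explicitly solvable for \<open>w\<close>.
\<close>

definition reD :: "real \<Rightarrow> real \<Rightarrow> int \<times> int \<Rightarrow> real" where
  "reD m w k = ((of_int (snd k))\<^sup>2 + m) / w - w * (of_int (fst k))\<^sup>2"

definition imD :: "real \<Rightarrow> int \<times> int \<Rightarrow> real" where
  "imD \<alpha> k = \<alpha> * of_int (fst k) * (of_int (snd k))\<^sup>2"

definition divisor :: "real \<Rightarrow> real \<Rightarrow> real \<Rightarrow> int \<times> int \<Rightarrow> complex" where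
  "divisor m w \<alpha> k = Complex (reD m w k) (imD \<alpha> k)"

lemma reD_le: "\<bar>reD m w k\<bar> \<le> cmod (divisor m w \<alpha> k)"
  and imD_le: "\<bar>imD \<alpha> k\<bar> \<le> cmod (divisor m w \<alpha> k)"
  using abs_Re_le_cmod[of "divisor m w \<alpha> k"] abs_Im_le_cmod[of "divisor m w \<alpha> k"]
  by (simp_all add: divisor_def)

lemma divisor_uminus: "divisor m w \<alpha> (- k) = cnj (divisor m w \<alpha> k)"
  and divisor_xflip: "divisor m w \<alpha> (xflip k) = divisor m w \<alpha> k"
  by (simp_all add: divisor_def reD_def imD_def xflip_def complex_eq_iff)

definition resonant :: "int \<times> int \<Rightarrow> bool" where
  "resonant k \<longleftrightarrow> \<bar>fst k\<bar> = 1 \<and> \<bar>snd k\<bar> = 1"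

lemma resonant_uminus [simp]: "resonant (- k) = resonant k"
  and resonant_xflip [simp]: "resonant (xflip k) = resonant k"
  by (simp_all add: resonant_def xflip_def)

text \<open>
  A zero would mean \<open>m (1 - l\<^sup>2) = l\<^sup>2 - j\<^sup>2\<close>, so that \<open>m\<close> would be rational unless \<open>l\<^sup>2 = j\<^sup>2 = 1\<close>.
\<close>

lemma nonresonant_reD:
  assumes m: "m > 0" "m \<notin> \<rat>" and k: "\<not> resonant k"
  shows "reD m (sqrt (1 + m)) k \<noteq> 0"
proof
  define l j where "l = fst k" and "j = snd k"
  assume "reD m (sqrt (1 + m)) k = 0"
  then have "(of_int j)\<^sup>2 + m = (1 + m) * (of_int l)\<^sup>2"
  proof -
    have "sqrt (1 + m) > 0" "sqrt (1 + m) * sqrt (1 + m) = 1 + m" using m by simp_all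
    moreover have "((of_int j)\<^sup>2 + m) / sqrt (1 + m) = sqrt (1 + m) * (of_int l)\<^sup>2"
      using \<open>reD m (sqrt (1 + m)) k = 0\<close> by (simp add: reD_def l_def j_def)
    ultimately show ?thesis by (metis mult.assoc mult.commute nonzero_eq_divide_eq less_irrefl)
  qed
  then have eq: "m * of_int (1 - l\<^sup>2) = of_int (l\<^sup>2 - j\<^sup>2)" by (simp add: algebra_simps)
  show False
  proof (cases "l\<^sup>2 = 1")
    case True
    then have "of_int (l\<^sup>2 - j\<^sup>2) = (0 :: real)" using eq by simp
    then have "j\<^sup>2 = 1" using True by (simp only: of_int_eq_0_iff)
    with True have "resonant k" by (auto simp: resonant_def l_def j_def power2_eq_1_iff)
    with k show False by simp
  next
    case False
    then have "(of_int (1 - l\<^sup>2) :: real) \<noteq> 0" by (simp only: of_int_eq_0_iff)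
    then have "m = of_int (l\<^sup>2 - j\<^sup>2) / of_int (1 - l\<^sup>2)" using eq by (simp add: field_simps)
    then have "m \<in> \<rat>" by (metis Rats_divide Rats_of_int)
    with m show False by simp
  qed
qed

text \<open>
  At a fixed nonresonant mode the divisor has a positive limit as \<open>w\<close> tends to \<open>sqrt (1 + m)\<close>, and \<open>g\<close>
  tends to zero.
\<close>

lemma divisor_bound_single_mode:
  assumes m: "m > 0" "m \<notin> \<rat>" and k: "\<not> resonant k" and \<theta>: "\<theta> > 0"
  shows "\<forall>\<^sub>F g in at_right 0. \<forall>w. \<bar>w - sqrt (1 + m)\<bar> \<le> K * g \<longrightarrow> g * \<bar>of_int (fst k)\<bar> \<le> \<theta> * \<bar>reD m w k\<bar>"
proof -
  let ?w0 = "sqrt (1 + m)"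
  let ?\<delta> = "\<bar>reD m ?w0 k\<bar>"
  have \<delta>: "?\<delta> > 0" using nonresonant_reD[OF m k] by simp
  have "isCont (\<lambda>w. \<bar>reD m w k\<bar>) ?w0"
    unfolding reD_def using m by (intro continuous_intros) auto
  then have "(\<lambda>w. \<bar>reD m w k\<bar>) \<midarrow>?w0\<rightarrow> ?\<delta>" by (simp add: isCont_def)
  from LIM_D[OF this, of "?\<delta> / 2"] \<delta> obtain d where d: "d > 0"
    "\<And>w. w \<noteq> ?w0 \<Longrightarrow> norm (w - ?w0) < d \<Longrightarrow> norm (\<bar>reD m w k\<bar> - ?\<delta>) < ?\<delta> / 2" by auto
  have half: "\<bar>reD m w k\<bar> \<ge> ?\<delta> / 2" if "\<bar>w - ?w0\<bar> < d" for w
  proof (cases "w = ?w0")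
    case False
    then have "\<bar>\<bar>reD m w k\<bar> - ?\<delta>\<bar> < ?\<delta> / 2" using d(2)[of w] that by simp
    then show ?thesis by linarith
  qed (use \<delta> in simp)
  have "((\<lambda>g. K * g) \<longlongrightarrow> K * 0) (at_right 0)" by (intro tendsto_intros)
  then have e1: "\<forall>\<^sub>F g in at_right 0. K * g < d" using d(1) by (auto dest: order_tendstoD(2))
  have "((\<lambda>g. g * \<bar>of_int (fst k)\<bar> :: real) \<longlongrightarrow> 0 * \<bar>of_int (fst k)\<bar>) (at_right 0)" by (intro tendsto_intros)
  then have e2: "\<forall>\<^sub>F g in at_right 0. g * \<bar>of_int (fst k)\<bar> < \<theta> * (?\<delta> / 2)"
    using order_tendstoD(2)[where a = "\<theta> * (?\<delta> / 2)"] \<delta> \<theta> by fastforce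
  from e1 e2 show ?thesis
  proof eventually_elim
    case (elim g)
    show ?case
    proof (intro allI impI)
      fix w assume "\<bar>w - ?w0\<bar> \<le> K * g"
      with elim(1) have "\<bar>reD m w k\<bar> \<ge> ?\<delta> / 2" by (intro half) simp
      then have "\<theta> * (?\<delta> / 2) \<le> \<theta> * \<bar>reD m w k\<bar>" using \<theta> by (intro mult_left_mono) auto
      with elim(2) show "g * \<bar>of_int (fst k)\<bar> \<le> \<theta> * \<bar>reD m w k\<bar>" by linarith
    qed
  qed
qed

text \<open>
  Where \<open>|l|\<close> is large compared to \<open>|j|\<close>, two time derivatives outweigh the rest of the operator.
\<close>

lemma divisor_far_from_cone:
  assumes m: "m > 0" and w: "w \<ge> sqrt (1 + m) / 2" and j: "snd k \<noteq> 0"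
    and far: "(fst k)\<^sup>2 > 8 * (snd k)\<^sup>2"
  shows "sqrt (1 + m) / 4 * (of_int (fst k))\<^sup>2 \<le> \<bar>reD m w k\<bar>"
proof -
  define l j :: real where "l = of_int (fst k)" and "j = of_int (snd k)"
  have w0: "sqrt (1 + m) > 0" using m by simp
  with w have wpos: "w > 0" by linarith
  have "1 \<le> \<bar>snd k\<bar>" using j by linarith
  then have "(1::real) \<le> \<bar>j\<bar>" unfolding j_def by (metis of_int_1_le_iff of_int_abs)
  then have j1: "1 \<le> j\<^sup>2" by (simp add: abs_le_square_iff[of 1 j, simplified])
  have "real_of_int (8 * (snd k)\<^sup>2) \<le> real_of_int ((fst k)\<^sup>2)" using far by (intro of_int_le_iff[THEN iffD2]) simp
  then have lj: "8 * j\<^sup>2 \<le> l\<^sup>2" by (simp add: l_def j_def)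
  have "(sqrt (1 + m) / 2)\<^sup>2 \<le> w\<^sup>2" using w w0 by (intro power_mono) auto
  then have w2: "(1 + m) / 4 \<le> w\<^sup>2" using m by (simp add: power_divide)
  have "m * 1 \<le> m * j\<^sup>2" using m j1 by (intro mult_left_mono) auto
  then have "2 * (j\<^sup>2 + m) \<le> (1 + m) / 4 * (8 * j\<^sup>2)" by (simp add: algebra_simps)
  also have "\<dots> \<le> w\<^sup>2 * l\<^sup>2" using w2 lj m by (intro mult_mono) auto
  finally have "(j\<^sup>2 + m) / w \<le> w * l\<^sup>2 / 2" using wpos by (simp add: field_simps power2_eq_square)
  then have "w * l\<^sup>2 / 2 \<le> \<bar>(j\<^sup>2 + m) / w - w * l\<^sup>2\<bar>" by linarith
  then have "w * l\<^sup>2 / 2 \<le> \<bar>reD m w k\<bar>" by (simp only: reD_def l_def j_def)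
  moreover have "sqrt (1 + m) / 4 * l\<^sup>2 \<le> w * l\<^sup>2 / 2"
    using mult_right_mono[OF w, of "l\<^sup>2"] by simp
  ultimately show ?thesis by (simp add: l_def)
qed

lemma imD_lower:
  assumes "\<alpha> \<ge> \<kappa> * g" "\<kappa> > 0" "g > 0"
  shows "\<kappa> * g * (\<bar>of_int (fst k)\<bar> * (of_int (snd k))\<^sup>2) \<le> cmod (divisor m w \<alpha> k)"
proof -
  have "\<kappa> * g \<le> \<bar>\<alpha>\<bar>" using assms by linarith
  then have "\<kappa> * g * (\<bar>of_int (fst k)\<bar> * (of_int (snd k))\<^sup>2) \<le> \<bar>\<alpha>\<bar> * (\<bar>of_int (fst k)\<bar> * (of_int (snd k))\<^sup>2)"
    by (intro mult_right_mono) auto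
  also have "\<dots> = \<bar>imD \<alpha> k\<bar>" by (simp add: imD_def abs_mult mult.assoc)
  finally show ?thesis using imD_le order_trans by blast
qed

lemma abs_le_int_square: "\<bar>of_int l :: real\<bar> \<le> (of_int l)\<^sup>2"
proof -
  have "\<bar>l\<bar> * 1 \<le> \<bar>l\<bar> * \<bar>l\<bar>"
  proof (cases "l = 0")
    case False
    then have "1 \<le> \<bar>l\<bar>" by linarith
    then show ?thesis by (intro mult_left_mono) auto
  qed simp
  then have "\<bar>l\<bar> \<le> l\<^sup>2" by (simp add: power2_eq_square)
  then show ?thesis by (metis of_int_abs of_int_le_iff of_int_power)
qed

text \<open>
  The decisive estimate: the multiplier \<open>g l / D\<close> is uniformly small. Three regimes are distinguished. If
  \<open>l\<^sup>2 > 8 j\<^sup>2\<close>, then \<open>|D|\<close> is of order \<open>l\<^sup>2\<close> and smallness comes from \<open>g\<close>. Otherwise, for \<open>|j|\<close> above a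
  threshold \<open>N\<close>, the damping gives \<open>|g l / D| \<le> 1 / (\<kappa> j\<^sup>2)\<close>, and smallness comes from \<open>N\<close>. The modes that
  remain are finite in number, and each of them is nonresonant.
\<close>

lemma divisor_bound:
  assumes m: "m > 0" "m \<notin> \<rat>" and \<kappa>: "\<kappa> > 0" and K: "K \<ge> 0" and \<theta>: "\<theta> > 0"
  shows "\<exists>g0>0. \<forall>g w \<alpha> k. 0 < g \<longrightarrow> g < g0 \<longrightarrow> \<bar>w - sqrt (1 + m)\<bar> \<le> K * g \<longrightarrow> \<kappa> * g \<le> \<alpha> \<longrightarrow>
     snd k \<noteq> 0 \<longrightarrow> \<not> resonant k \<longrightarrow> g * \<bar>of_int (fst k)\<bar> \<le> \<theta> * cmod (divisor m w \<alpha> k)"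
proof -
  let ?w0 = "sqrt (1 + m)"
  have w0: "?w0 > 0" using m by simp
  obtain N :: nat where N: "real N > 1 / (\<kappa> * \<theta>)" using reals_Archimedean2 by blast
  define A :: "(int \<times> int) set" where "A = {k. \<not> resonant k \<and> \<bar>fst k\<bar> \<le> 3 * int N \<and> \<bar>snd k\<bar> \<le> int N}"
  have "A \<subseteq> {- (3 * int N)..3 * int N} \<times> {- int N..int N}" by (auto simp: A_def)
  then have finA: "finite A" by (rule finite_subset) auto
  have "\<forall>\<^sub>F g in at_right 0. \<forall>k\<in>A. \<forall>w. \<bar>w - ?w0\<bar> \<le> K * g \<longrightarrow> g * \<bar>of_int (fst k)\<bar> \<le> \<theta> * \<bar>reD m w k\<bar>"
    by (intro eventually_ball_finite finA ballI divisor_bound_single_mode m \<theta>) (simp add: A_def)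
  moreover have "((\<lambda>g. K * g) \<longlongrightarrow> K * 0) (at_right 0)" by (intro tendsto_intros)
  then have "\<forall>\<^sub>F g in at_right 0. K * g < ?w0 / 2"
    by (rule order_tendstoD(2)) (use w0 in simp)
  moreover have "((\<lambda>g::real. g) \<longlongrightarrow> 0) (at_right 0)" by (intro tendsto_intros)
  then have "\<forall>\<^sub>F g in at_right 0. g < \<theta> * (?w0 / 4)"
    by (rule order_tendstoD(2)) (use w0 \<theta> in simp)
  ultimately have "\<forall>\<^sub>F g in at_right 0. (\<forall>k\<in>A. \<forall>w. \<bar>w - ?w0\<bar> \<le> K * g \<longrightarrow> g * \<bar>of_int (fst k)\<bar> \<le> \<theta> * \<bar>reD m w k\<bar>)
      \<and> K * g < ?w0 / 2 \<and> g < \<theta> * (?w0 / 4)"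
    by eventually_elim simp
  then obtain g0 where g0: "g0 > 0" "\<And>g. 0 < g \<Longrightarrow> g < g0 \<Longrightarrow>
      (\<forall>k\<in>A. \<forall>w. \<bar>w - ?w0\<bar> \<le> K * g \<longrightarrow> g * \<bar>of_int (fst k)\<bar> \<le> \<theta> * \<bar>reD m w k\<bar>)
      \<and> K * g < ?w0 / 2 \<and> g < \<theta> * (?w0 / 4)"
    unfolding eventually_at_right_field by auto
  show ?thesis
  proof (intro exI[of _ g0] conjI g0 allI impI)
    fix g w \<alpha> and k :: "int \<times> int"
    assume g: "0 < g" "g < g0" and w: "\<bar>w - ?w0\<bar> \<le> K * g" and \<alpha>: "\<kappa> * g \<le> \<alpha>"
      and j: "snd k \<noteq> 0" and nr: "\<not> resonant k"
    note G = g0(2)[OF g]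
    let ?l = "of_int (fst k) :: real" and ?j = "of_int (snd k) :: real"
    show "g * \<bar>?l\<bar> \<le> \<theta> * cmod (divisor m w \<alpha> k)"
    proof (cases "(fst k)\<^sup>2 > 8 * (snd k)\<^sup>2")
      case True
      have "w \<ge> ?w0 / 2" using w G by linarith
      from divisor_far_from_cone[OF m(1) this j True]
      have "?w0 / 4 * ?l\<^sup>2 \<le> cmod (divisor m w \<alpha> k)" using reD_le order_trans by blast
      then have "\<theta> * (?w0 / 4 * ?l\<^sup>2) \<le> \<theta> * cmod (divisor m w \<alpha> k)"
        using \<theta> by (intro mult_left_mono) auto
      moreover have "g * \<bar>?l\<bar> \<le> (\<theta> * (?w0 / 4)) * ?l\<^sup>2"
        using G g by (intro mult_mono abs_le_int_square) auto
      ultimately show ?thesis by (simp add: mult.assoc)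
    next
      case near: False
      show ?thesis
      proof (cases "\<bar>snd k\<bar> \<le> int N")
        case True
        have "(fst k)\<^sup>2 \<le> 8 * (snd k)\<^sup>2" using near by simp
        also have "\<dots> \<le> (3 * \<bar>snd k\<bar>)\<^sup>2" by (simp add: power_mult_distrib)
        finally have "\<bar>fst k\<bar> \<le> \<bar>3 * \<bar>snd k\<bar>\<bar>" by (simp only: abs_le_square_iff)
        then have "k \<in> A" using True nr by (simp add: A_def)
        then have "g * \<bar>?l\<bar> \<le> \<theta> * \<bar>reD m w k\<bar>" using G w by blast
        also have "\<dots> \<le> \<theta> * cmod (divisor m w \<alpha> k)" using \<theta> reD_le by (intro mult_left_mono) auto
        finally show ?thesis .
      next
        case False
        then have "real N < \<bar>?j\<bar>" by (metis linorder_not_less of_int_abs of_int_less_iff of_int_of_nat_eq)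
        then have "1 / (\<kappa> * \<theta>) < ?j\<^sup>2" using N abs_le_int_square[of "snd k"] by linarith
        then have "1 \<le> \<theta> * \<kappa> * ?j\<^sup>2" using \<kappa> \<theta> by (simp add: field_simps)
        then have "g * \<bar>?l\<bar> * 1 \<le> g * \<bar>?l\<bar> * (\<theta> * \<kappa> * ?j\<^sup>2)" using g by (intro mult_left_mono) auto
        also have "\<dots> = \<theta> * (\<kappa> * g * (\<bar>?l\<bar> * ?j\<^sup>2))" by simp
        also have "\<dots> \<le> \<theta> * cmod (divisor m w \<alpha> k)"
          using \<theta> by (intro mult_left_mono imD_lower \<alpha> \<kappa> g) auto
        finally show ?thesis by simp
      qed
    qed
  qed
qed

text \<open>
  Up to a constant, an upper bound for the derivatives of the divisor with respect to \<open>w\<close> and \<open>\<alpha>\<close>.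
\<close>

definition full_symbol :: "real \<Rightarrow> int \<times> int \<Rightarrow> real" where
  "full_symbol m k = (of_int (snd k))\<^sup>2 + m + (of_int (fst k))\<^sup>2 + \<bar>of_int (fst k)\<bar> * (of_int (snd k))\<^sup>2"

text \<open>
  The divisor depends on the unknown through \<open>w\<close> and \<open>\<alpha>\<close>, which vary on the scale \<open>g\<close>. This bound says that
  such a variation changes the divisor by at most a constant multiple of itself. The damping controls all
  terms that contain \<open>j\<close>, and also \<open>l\<^sup>2\<close> as long as \<open>l\<^sup>2 \<le> 8 j\<^sup>2\<close>; for larger \<open>l\<^sup>2\<close> the real part does.
\<close>

lemma divisor_coercive:
  assumes m: "m > 0" and w: "w \<ge> sqrt (1 + m) / 2" and \<kappa>: "\<kappa> > 0" and g: "0 < g" "g \<le> 1"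
    and \<alpha>: "\<kappa> * g \<le> \<alpha>" and l: "fst k \<noteq> 0" and j: "snd k \<noteq> 0"
  shows "g * full_symbol m k \<le> ((10 + m) / \<kappa> + 4 / sqrt (1 + m)) * cmod (divisor m w \<alpha> k)"
proof -
  define l j where "l = \<bar>of_int (fst k) :: real\<bar>" and "j = (of_int (snd k) :: real)\<^sup>2"
  let ?D = "cmod (divisor m w \<alpha> k)"
  have w0: "sqrt (1 + m) > 0" using m by simp
  have "1 \<le> \<bar>fst k\<bar>" using assms(7) by linarith
  then have l1: "1 \<le> l" unfolding l_def by (metis of_int_1_le_iff of_int_abs)
  have "1 \<le> \<bar>snd k\<bar>" using assms(8) by linarith
  then have "1 \<le> \<bar>of_int (snd k) :: real\<bar>" by (metis of_int_1_le_iff of_int_abs)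
  then have j1: "1 \<le> j" unfolding j_def using abs_le_int_square[of "snd k"] by linarith
  have jl: "j \<le> l * j" using mult_right_mono[OF l1, of j] j1 by simp
  have "1 \<le> l * j" using jl j1 by linarith
  then have "m * 1 \<le> m * (l * j)" using m by (intro mult_left_mono) auto
  then have jm: "j + m + l * j \<le> (2 + m) * (l * j)" using jl by (simp add: algebra_simps)
  have glj: "g * (l * j) \<le> ?D / \<kappa>"
    using imD_lower[OF \<alpha> \<kappa> g(1), of k m w] \<kappa> by (simp add: l_def j_def field_simps)
  have gl: "g * l\<^sup>2 \<le> 8 * (?D / \<kappa>) + 4 / sqrt (1 + m) * ?D"
  proof (cases "(fst k)\<^sup>2 > 8 * (snd k)\<^sup>2")
    case True
    have "sqrt (1 + m) / 4 * l\<^sup>2 \<le> ?D"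
      using divisor_far_from_cone[OF m w assms(8) True] reD_le[of m w k \<alpha>] by (simp add: l_def)
    then have "l\<^sup>2 \<le> 4 / sqrt (1 + m) * ?D" using w0 by (simp add: field_simps)
    moreover have "g * l\<^sup>2 \<le> 1 * l\<^sup>2" using g by (intro mult_right_mono) auto
    moreover have "0 \<le> ?D / \<kappa>" using \<kappa> by simp
    ultimately show ?thesis by linarith
  next
    case False
    then have "real_of_int ((fst k)\<^sup>2) \<le> real_of_int (8 * (snd k)\<^sup>2)" by (intro of_int_le_iff[THEN iffD2]) simp
    then have "l\<^sup>2 \<le> 8 * j" by (simp add: l_def j_def)
    also have "\<dots> \<le> 8 * (l * j)" using jl by simp
    finally have "g * l\<^sup>2 \<le> g * (8 * (l * j))" using g by (intro mult_left_mono) auto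
    also have "\<dots> \<le> 8 * (?D / \<kappa>)" using glj by simp
    also have "0 \<le> 4 / sqrt (1 + m) * ?D" using w0 by simp
    ultimately show ?thesis by linarith
  qed
  have "g * (j + m + l * j) \<le> g * ((2 + m) * (l * j))" using jm g by (intro mult_left_mono) auto
  also have "\<dots> = (2 + m) * (g * (l * j))" by simp
  also have "\<dots> \<le> (2 + m) * (?D / \<kappa>)" using glj m by (intro mult_left_mono) auto
  finally have "g * (j + m + l\<^sup>2 + l * j) \<le> (2 + m) * (?D / \<kappa>) + (8 * (?D / \<kappa>) + 4 / sqrt (1 + m) * ?D)"
    using gl by (simp add: algebra_simps)
  also have "\<dots> = ((10 + m) / \<kappa> + 4 / sqrt (1 + m)) * ?D" by (simp add: algebra_simps add_divide_distrib)
  finally show ?thesis by (simp add: full_symbol_def l_def j_def)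
qed

lemma divisor_diff_le:
  assumes m: "m > 0" and w: "w \<ge> sqrt (1 + m) / 2" "w' \<ge> sqrt (1 + m) / 2"
    and d: "\<bar>w - w'\<bar> \<le> d" "\<bar>\<alpha> - \<alpha>'\<bar> \<le> d"
  shows "cmod (divisor m w \<alpha> k - divisor m w' \<alpha>' k) \<le> 4 * d * full_symbol m k"
proof -
  define l j where "l = (of_int (fst k) :: real)" and "j = (of_int (snd k) :: real)\<^sup>2"
  have "1 \<le> sqrt (1 + m)" using m by simp
  then have w0: "w \<ge> 1 / 2" "w' \<ge> 1 / 2" using w by linarith+
  have d0: "d \<ge> 0" using d by linarith
  have "1 / 2 * (1 / 2) \<le> w * w'" using w0 by (intro mult_mono) auto
  then have "\<bar>w' - w\<bar> / (w * w') \<le> d / (1 / 4)" using d d0 by (intro frac_le) auto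
  then have inv: "\<bar>1 / w - 1 / w'\<bar> \<le> 4 * d"
    using w0 by (simp add: diff_frac_eq abs_divide abs_mult)
  have "reD m w k - reD m w' k = (j + m) * (1 / w - 1 / w') - (w - w') * l\<^sup>2"
    by (simp add: reD_def l_def j_def add_divide_distrib algebra_simps)
  then have "\<bar>reD m w k - reD m w' k\<bar> \<le> \<bar>(j + m) * (1 / w - 1 / w')\<bar> + \<bar>(w - w') * l\<^sup>2\<bar>" by linarith
  also have "\<dots> = (j + m) * \<bar>1 / w - 1 / w'\<bar> + \<bar>w - w'\<bar> * l\<^sup>2"
    using m by (simp add: abs_mult j_def)
  also have "\<dots> \<le> (j + m) * (4 * d) + d * l\<^sup>2"
    using inv d m by (intro add_mono mult_mono) (auto simp: j_def)
  finally have re: "\<bar>reD m w k - reD m w' k\<bar> \<le> (j + m) * (4 * d) + d * l\<^sup>2" .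
  have "imD \<alpha> k - imD \<alpha>' k = (\<alpha> - \<alpha>') * (l * j)" by (simp add: imD_def l_def j_def algebra_simps)
  then have "\<bar>imD \<alpha> k - imD \<alpha>' k\<bar> = \<bar>\<alpha> - \<alpha>'\<bar> * (\<bar>l\<bar> * j)" by (simp add: abs_mult j_def)
  also have "\<dots> \<le> d * (\<bar>l\<bar> * j)" using d by (intro mult_right_mono) (auto simp: j_def)
  finally have im: "\<bar>imD \<alpha> k - imD \<alpha>' k\<bar> \<le> d * (\<bar>l\<bar> * j)" .
  have "cmod (divisor m w \<alpha> k - divisor m w' \<alpha>' k) \<le> \<bar>reD m w k - reD m w' k\<bar> + \<bar>imD \<alpha> k - imD \<alpha>' k\<bar>"
    using cmod_le[of "divisor m w \<alpha> k - divisor m w' \<alpha>' k"] by (simp add: divisor_def)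
  also have "\<dots> \<le> (j + m) * (4 * d) + d * l\<^sup>2 + d * (\<bar>l\<bar> * j)" using re im by linarith
  also have "\<dots> \<le> (j + m) * (4 * d) + 4 * (d * l\<^sup>2) + 4 * (d * (\<bar>l\<bar> * j))"
  proof -
    have "0 \<le> d * l\<^sup>2" "0 \<le> d * (\<bar>l\<bar> * j)" using d0 by (simp_all add: j_def)
    then show ?thesis by linarith
  qed
  also have "\<dots> = 4 * d * full_symbol m k"
    by (simp add: full_symbol_def l_def j_def algebra_simps)
  finally show ?thesis .
qed

section \<open>Powers of the leading term\<close>

definition resonant_modes :: "(int \<times> int) set" where
  "resonant_modes = {(1, 1), (1, - 1), (- 1, 1), (- 1, - 1)}"

lemma resonant_iff: "resonant k \<longleftrightarrow> k \<in> resonant_modes"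
  by (cases k) (auto simp: resonant_def resonant_modes_def abs_if split: if_splits)

lemma series_finite_support:
  assumes "finite S" "\<And>k. k \<notin> S \<Longrightarrow> a k = 0"
  shows "coef (series a) = a"
  by (rule coef_series, rule finite_nonzero_values_imp_summable_on, rule finite_subset[OF _ assms(1)])
     (use assms(2) in auto)

text \<open>
  The functions \<open>- sin t sin x\<close> and, below, \<open>cos t sin x\<close>; the first is the time derivative of the second.
\<close>

definition q0 :: wiener where
  "q0 = series (\<lambda>k. if resonant k then of_int (fst k * snd k) / 4 else 0)"

definition e0 :: wiener where
  "e0 = series (\<lambda>k. if resonant k then - \<i> * of_int (snd k) / 4 else 0)"

lemma coef_q0: "coef q0 k = (if resonant k then of_int (fst k * snd k) / 4 else 0)"
  and coef_e0: "coef e0 k = (if resonant k then - \<i> * of_int (snd k) / 4 else 0)"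
  unfolding q0_def e0_def resonant_iff
  by (subst series_finite_support[of resonant_modes]; simp add: resonant_modes_def)+

lemma herm_q0: "herm (coef q0)" and xsym_q0: "xsym (- 1) (coef q0)"
  and herm_e0: "herm (coef e0)" and xsym_e0: "xsym (- 1) (coef e0)"
  unfolding herm_def xsym_def by (simp_all add: coef_q0 coef_e0 del: split_paired_All) (simp_all add: xflip_def)

lemma ev_e0: "ev w (coef e0) t x = cos (w * t) * sin x"
proof -
  have "evc w (coef e0) t x = (\<Sum>k\<in>resonant_modes. coef e0 k * mode w t x k)"
    unfolding evc_def
    by (rule infsumI, rule has_sum_finite_neutralI[where B = resonant_modes]) (auto simp: coef_e0 resonant_iff resonant_modes_def)
  then have "ev w (coef e0) t x = (\<Sum>k\<in>resonant_modes. Re (coef e0 k * mode w t x k))"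
    by (simp add: ev_def Re_sum)
  also have "\<dots> = (\<Sum>k\<in>resonant_modes. of_int (snd k) / 4 * sin (of_int (fst k) * w * t + of_int (snd k) * x))"
    by (intro sum.cong refl) (simp add: coef_e0 resonant_iff mode_def)
  also have "\<dots> = (sin (w * t + x) - sin (w * t - x) + sin (- (w * t) + x) - sin (- (w * t) - x)) / 4"
    by (simp add: resonant_modes_def add_divide_distrib diff_divide_distrib)
  also have "\<dots> = cos (w * t) * sin x"
    by (simp only: sin_add sin_diff cos_minus sin_minus) (simp add: field_simps)
  finally show ?thesis .
qed

text \<open>
  The coefficient of \<open>exp(i l t)\<close> in \<open>(i sin t)\<^sup>n\<^sup>+\<^sup>1\<close>. Since \<open>- sin t sin x = (i sin t)(i sin x)\<close>, the powers of
  \<open>q0\<close> have product coefficients.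
\<close>

primrec sine_power_coeff :: "nat \<Rightarrow> int \<Rightarrow> real" where
  "sine_power_coeff 0 l = (if l = 1 then 1 / 2 else if l = - 1 then - 1 / 2 else 0)"
| "sine_power_coeff (Suc n) l = (sine_power_coeff n (l - 1) - sine_power_coeff n (l + 1)) / 2"

lemma sine_power_coeff_eq_0: "\<bar>l\<bar> > int n + 1 \<Longrightarrow> sine_power_coeff n l = 0"
  by (induction n arbitrary: l) auto

lemma sine_power_coeff_binomial:
  "sine_power_coeff n (int n + 1 - 2 * int i) = (- 1) ^ i * real (Suc n choose i) / 2 ^ Suc n"
proof (induction n arbitrary: i)
  case 0
  consider "i = 0" | "i = 1" | "i \<ge> 2" by linarith
  then show ?case by cases (auto simp: binomial_eq_0)
next
  case (Suc n)
  have 1: "int (Suc n) + 1 - 2 * int i - 1 = int n + 1 - 2 * int i" by simp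
  show ?case
  proof (cases i)
    case 0
    have "sine_power_coeff n (int (Suc n) + 1 - 2 * int i + 1) = 0"
      using 0 by (intro sine_power_coeff_eq_0) simp
    then show ?thesis using 0 Suc.IH[of 0] unfolding sine_power_coeff.simps 1 by simp
  next
    case (Suc i')
    have 2: "int (Suc n) + 1 - 2 * int i + 1 = int n + 1 - 2 * int i'" using Suc by simp
    have "sine_power_coeff (Suc n) (int (Suc n) + 1 - 2 * int i)
        = ((- 1) ^ i * real (Suc n choose i) / 2 ^ Suc n - (- 1) ^ i' * real (Suc n choose i') / 2 ^ Suc n) / 2"
      unfolding sine_power_coeff.simps 1 2 Suc.IH ..
    also have "\<dots> = (- 1) ^ i * (real (Suc n choose i) + real (Suc n choose i')) / 2 ^ Suc (Suc n)"
      unfolding Suc by (simp add: field_simps del: binomial_Suc_Suc)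
    also have "real (Suc n choose i) + real (Suc n choose i') = real (Suc (Suc n) choose i)"
      unfolding Suc binomial_Suc_Suc[of "Suc n"] by simp
    finally show ?thesis .
  qed
qed

lemma coef_conv_q0:
  "coef (q0 \<star> a) (l, j) = (coef a (l - 1, j - 1) - coef a (l - 1, j + 1)
      - coef a (l + 1, j - 1) + coef a (l + 1, j + 1)) / 4"
proof -
  have "coef (q0 \<star> a) (l, j) = (\<Sum>k\<in>resonant_modes. coef q0 k * coef a ((l, j) - k))"
    unfolding coef_conv
    by (rule infsumI, rule has_sum_finite_neutralI[where B = resonant_modes]) (auto simp: coef_q0 resonant_iff resonant_modes_def)
  also have "\<dots> = (\<Sum>k\<in>resonant_modes. of_int (fst k * snd k) / 4 * coef a ((l, j) - k))"
    by (intro sum.cong refl) (simp add: coef_q0 resonant_iff)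
  finally show ?thesis by (simp add: resonant_modes_def add_divide_distrib diff_divide_distrib)
qed

lemma coef_wpow_q0: "coef (wpow q0 n) (l, j) = of_real (sine_power_coeff n l * sine_power_coeff n j)"
proof (induction n arbitrary: l j)
  case 0
  show ?case by (auto simp: coef_q0 resonant_def abs_if)
next
  case (Suc n)
  show ?case by (simp add: coef_conv_q0 Suc field_simps)
qed

text \<open>
  At the mode \<open>(1,1)\<close> both factors are the same real binomial coefficient up to normalisation, so the
  product is a positive square. The positivity of the damping rests on this.
\<close>

lemma coef_wpow_q0_resonant:
  obtains \<kappa> where "\<kappa> > 0" "coef (wpow q0 (2 * p)) (1, 1) = of_real \<kappa>"
proof
  have "int (2 * p) + 1 - 2 * int p = 1" by simp
  then have "sine_power_coeff (2 * p) 1 \<noteq> 0"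
    using sine_power_coeff_binomial[of "2 * p" p] by simp
  then show "sine_power_coeff (2 * p) 1 * sine_power_coeff (2 * p) 1 > 0"
    by (metis not_real_square_gt_zero)
  show "coef (wpow q0 (2 * p)) (1, 1) = of_real (sine_power_coeff (2 * p) 1 * sine_power_coeff (2 * p) 1)"
    by (rule coef_wpow_q0)
qed

section \<open>The fixed point\<close>

definition nonlin :: "nat \<Rightarrow> wiener \<Rightarrow> wiener" where
  "nonlin p z = wpow (q0 + z) (2 * p)"

text \<open>
  Frequency and damping are read off from the resonant coefficient of the nonlinear term in such a way that
  the resonant part of the equation holds for every \<open>z\<close> (\<open>divisor_resonant\<close> below).
\<close>

definition freq_of :: "nat \<Rightarrow> real \<Rightarrow> real \<Rightarrow> wiener \<Rightarrow> real" where
  "freq_of p m g z = freq m (g * Im (coef (nonlin p z) (1, 1)))"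

definition damping_of :: "nat \<Rightarrow> real \<Rightarrow> wiener \<Rightarrow> real" where
  "damping_of p g z = 4 * g * Re (coef (nonlin p z) (1, 1))"

text \<open>
  The modes with \<open>j = 0\<close> are set to zero; no coefficient is lost, since the functions are odd in \<open>x\<close>.
\<close>

definition inv_symbol :: "nat \<Rightarrow> real \<Rightarrow> real \<Rightarrow> wiener \<Rightarrow> int \<times> int \<Rightarrow> complex" where
  "inv_symbol p m g z k = (if resonant k \<or> snd k = 0 then 0
      else \<i> * of_real g * of_int (fst k) / divisor m (freq_of p m g z) (damping_of p g z) k)"

definition range_map :: "nat \<Rightarrow> real \<Rightarrow> real \<Rightarrow> wiener \<Rightarrow> wiener" where
  "range_map p m g z = diag (inv_symbol p m g z) (nonlin p z)"

definition sym_ball :: "real \<Rightarrow> wiener set" where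
  "sym_ball R = {z. norm z \<le> R \<and> herm (coef z) \<and> xsym (- 1) (coef z) \<and> (\<forall>k. resonant k \<longrightarrow> coef z k = 0)}"

lemma continuous_coef: "continuous_on UNIV (\<lambda>z. coef z k)"
proof (rule continuous_onI)
  fix z e assume "(e::real) > 0"
  then show "\<exists>d>0. \<forall>z'\<in>UNIV. dist z' z < d \<longrightarrow> dist (coef z' k) (coef z k) \<le> e"
    using cmod_coef_le[of _ k] by (intro exI[of _ e]) (metis coef_diff dist_norm less_imp_le order_trans)
qed

lemma complete_sym_ball: "complete (sym_ball R)"
proof -
  have "closed (\<Inter>k. {z. coef z (- k) = cnj (coef z k)})"
    "closed (\<Inter>k. {z. coef z (xflip k) = of_real (- 1) * coef z k})"
    "closed (\<Inter>k\<in>{k. resonant k}. {z. coef z k = 0})" "closed {z::wiener. norm z \<le> R}"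
    by (intro closed_INT ballI closed_Collect_eq closed_Collect_le continuous_intros continuous_coef)+
  then have "closed ({z::wiener. norm z \<le> R} \<inter> (\<Inter>k. {z. coef z (- k) = cnj (coef z k)})
      \<inter> (\<Inter>k. {z. coef z (xflip k) = of_real (- 1) * coef z k}) \<inter> (\<Inter>k\<in>{k. resonant k}. {z. coef z k = 0}))"
    by (intro closed_Int)
  also have "\<dots> = sym_ball R" unfolding sym_ball_def herm_def xsym_def by blast
  finally show ?thesis by (simp add: complete_eq_closed)
qed

lemma herm_add: "herm (coef a) \<Longrightarrow> herm (coef b) \<Longrightarrow> herm (coef (a + b))"
  by (simp add: herm_def del: split_paired_All)

lemma xsym_add: "xsym r (coef a) \<Longrightarrow> xsym r (coef b) \<Longrightarrow> xsym r (coef (a + b))"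
  by (simp add: xsym_def distrib_left del: split_paired_All)

lemma herm_scaleR: "herm (coef a) \<Longrightarrow> herm (coef (r *\<^sub>R a))"
  by (simp add: herm_def scaleR_conv_of_real del: split_paired_All)

lemma xsym_scaleR: "xsym s (coef a) \<Longrightarrow> xsym s (coef (r *\<^sub>R a))"
  by (simp add: xsym_def scaleR_conv_of_real del: split_paired_All)

lemma
  assumes "z \<in> sym_ball R"
  shows herm_nonlin: "herm (coef (nonlin p z))" and xsym_nonlin: "xsym (- 1) (coef (nonlin p z))"
proof -
  have "herm (coef (q0 + z))" "xsym (- 1) (coef (q0 + z))"
    using assms by (auto simp: sym_ball_def intro: herm_add xsym_add herm_q0 xsym_q0)
  then show "herm (coef (nonlin p z))" "xsym (- 1) (coef (nonlin p z))"
    using xsym_wpow[of "- 1" "q0 + z" "2 * p"] by (simp_all add: nonlin_def herm_wpow)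
qed

lemma inv_symbol_uminus: "inv_symbol p m g z (- k) = cnj (inv_symbol p m g z k)"
  and inv_symbol_xflip: "inv_symbol p m g z (xflip k) = inv_symbol p m g z k"
  by (simp_all add: inv_symbol_def divisor_uminus divisor_xflip) (simp_all add: xflip_def)

text \<open>
  The map \<open>range_map\<close> is a contraction of a small symmetric ball. The radius \<open>R\<close> keeps the resonant
  coefficient, hence the damping, near its positive value at \<open>z = 0\<close>. The bound \<open>\<theta>\<close> on the multiplier makes
  both the range and the Lipschitz constant small. The dependence of the multiplier itself on \<open>z\<close> costs only
  a constant times \<open>\<theta>\<close>, by \<open>divisor_coercive\<close>. Comparison with the image of \<open>0\<close>, a trigonometric
  polynomial of size \<open>O(g)\<close>, gives the estimate of the fixed point.
\<close>

proposition fixed_point: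
  assumes m: "m > 0" "m \<notin> \<rat>"
  shows "\<exists>g0 \<kappa> K. g0 > 0 \<and> \<kappa> > 0 \<and> K > 0 \<and> (\<forall>g. 0 < g \<longrightarrow> g < g0 \<longrightarrow>
     (\<exists>z. z \<in> sym_ball 1 \<and> norm z \<le> K * g \<and> norm (nonlin p z) \<le> K
       \<and> \<kappa> * g \<le> damping_of p g z \<and> \<bar>freq_of p m g z - sqrt (1 + m)\<bar> \<le> K * g
       \<and> sqrt (1 + m) / 2 \<le> freq_of p m g z
       \<and> (\<forall>k. coef z k = inv_symbol p m g z k * coef (nonlin p z) k)
       \<and> (\<forall>k. fst k \<noteq> 0 \<longrightarrow> snd k \<noteq> 0 \<longrightarrow> divisor m (freq_of p m g z) (damping_of p g z) k \<noteq> 0)))"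
proof -
  let ?w0 = "sqrt (1 + m)"
  have w0: "?w0 > 0" using m by simp
  obtain \<kappa> where \<kappa>: "\<kappa> > 0" and Q0: "coef (wpow q0 (2 * p)) (1, 1) = of_real \<kappa>"
    by (rule coef_wpow_q0_resonant)
  define B where "B = norm q0 + 1"
  define BQ where "BQ = B ^ Suc (2 * p)"
  define L where "L = real (Suc (2 * p)) * B ^ (2 * p)"
  have B: "B \<ge> 1" by (simp add: B_def)
  then have BQ: "BQ \<ge> 1" by (simp add: BQ_def one_le_power del: power_Suc)
  have L: "L > 0" using B by (simp add: L_def)
  \<comment> \<open>For \<open>norm z \<le> R\<close> the resonant coefficient changes by at most \<open>L * R \<le> \<kappa> / 2\<close>.\<close>
  define R where "R = min 1 (\<kappa> / (2 * L))"
  have R: "R > 0" "R \<le> 1" "L * R \<le> \<kappa> / 2" using \<kappa> L by (auto simp: R_def min_def field_simps)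
  define C where "C = (10 + m) / (2 * \<kappa>) + 4 / ?w0"
  have C: "C > 0" using m \<kappa> w0 by (auto simp: C_def intro!: add_pos_pos divide_pos_pos)
  \<comment> \<open>The first bound keeps the image in the ball of radius \<open>R\<close>, the second makes the Lipschitz constant \<open>1 / 2\<close>.\<close>
  define \<theta> where "\<theta> = min (R / BQ) (1 / (2 * ((1 + 16 * C * BQ) * L)))"
  have den: "(1 + 16 * C * BQ) * L > 0" using C BQ L by (intro mult_pos_pos add_pos_nonneg) auto
  have \<theta>: "\<theta> > 0" "\<theta> * BQ \<le> R" "\<theta> * ((1 + 16 * C * BQ) * L) \<le> 1 / 2"
  proof -
    show "\<theta> > 0" using R BQ den unfolding \<theta>_def min_less_iff_conj by (auto intro!: divide_pos_pos)
    have "\<theta> * BQ \<le> R / BQ * BQ" using BQ by (intro mult_right_mono) (auto simp: \<theta>_def)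
    then show "\<theta> * BQ \<le> R" using BQ by simp
    have "\<theta> * ((1 + 16 * C * BQ) * L) \<le> 1 / (2 * ((1 + 16 * C * BQ) * L)) * ((1 + 16 * C * BQ) * L)"
      using den by (intro mult_right_mono) (auto simp: \<theta>_def)
    also have "\<dots> = 1 / 2" using den by (simp add: field_simps)
    finally show "\<theta> * ((1 + 16 * C * BQ) * L) \<le> 1 / 2" .
  qed
  \<comment> \<open>Frequencies stay within \<open>4 * BQ * g\<close> of \<open>sqrt (1 + m)\<close>, and the damping is at least \<open>2 * \<kappa> * g\<close>.\<close>
  obtain g1 where g1: "g1 > 0" "\<And>g w \<alpha> k. 0 < g \<Longrightarrow> g < g1 \<Longrightarrow> \<bar>w - ?w0\<bar> \<le> (4 * BQ) * g \<Longrightarrow> 2 * \<kappa> * g \<le> \<alpha> \<Longrightarrow>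
     snd k \<noteq> 0 \<Longrightarrow> \<not> resonant k \<Longrightarrow> g * \<bar>of_int (fst k)\<bar> \<le> \<theta> * cmod (divisor m w \<alpha> k)"
    using divisor_bound[OF m, of "2 * \<kappa>" "4 * BQ" \<theta>] \<kappa> BQ \<theta> by auto
  define g0 where "g0 = min (min g1 1) (?w0 / (8 * BQ))"
  have g0: "g0 > 0" using g1 w0 BQ by (simp add: g0_def)
  \<comment> \<open>This box contains the support of the power of \<open>q0\<close>. The resonant modes lie in it with divisor zero and
    add \<open>1 / 0 = 0\<close> to the sum.\<close>
  define S0 where "S0 = {- (2 * int p + 1)..2 * int p + 1} \<times> {- (2 * int p + 1)..2 * int p + 1}"
  define K0 where "K0 = (\<Sum>k\<in>S0. \<bar>of_int (fst k)\<bar> / \<bar>reD m ?w0 k\<bar>)"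
  have K0: "K0 \<ge> 0" by (auto simp: K0_def intro!: sum_nonneg)
  define K where "K = max (2 * (K0 * BQ)) (4 * BQ)"
  have K: "K > 0" "2 * (K0 * BQ) \<le> K" "4 * BQ \<le> K" "BQ \<le> K" using BQ by (auto simp: K_def)
  show ?thesis
  proof (rule exI[of _ g0], rule exI[of _ "2 * \<kappa>"], rule exI[of _ K], intro conjI allI impI g0 K)
    show "2 * \<kappa> > 0" using \<kappa> by simp
    fix g :: real assume g: "0 < g" "g < g0"
    then have gb: "g < g1" "g < 1" "4 * BQ * g \<le> ?w0 / 2"
      using BQ by (auto simp: g0_def field_simps)
    have nl0: "nonlin p 0 = wpow q0 (2 * p)" by (simp add: nonlin_def)
    have ball: "norm (q0 + z) \<le> B" if "norm z \<le> R" for z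
      using norm_triangle_ineq[of q0 z] that R by (simp add: B_def)
    have nl_bd: "norm (nonlin p z) \<le> BQ" if "norm z \<le> R" for z
      using norm_wpow_le[of "q0 + z" "2 * p"] power_mono[OF ball[OF that], of "Suc (2 * p)"]
      by (simp add: nonlin_def BQ_def)
    have nl_lip: "norm (nonlin p z - nonlin p z') \<le> L * norm (z - z')" if "norm z \<le> R" "norm z' \<le> R" for z z'
      using norm_wpow_diff_le[OF ball[OF that(1)] ball[OF that(2)], of "2 * p"] by (simp add: nonlin_def L_def)
    have al: "2 * \<kappa> * g \<le> damping_of p g z" if "norm z \<le> R" for z
    proof -
      have "\<bar>Re (coef (nonlin p z) (1, 1)) - \<kappa>\<bar> \<le> cmod (coef (nonlin p z - nonlin p 0) (1, 1))"
        using abs_Re_le_cmod[of "coef (nonlin p z - nonlin p 0) (1, 1)"] by (simp add: nl0 Q0)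
      also have "\<dots> \<le> norm (nonlin p z - nonlin p 0)" by (rule cmod_coef_le)
      also have "\<dots> \<le> L * norm z" using nl_lip[of z 0] that R by simp
      also have "\<dots> \<le> L * R" using that L by (intro mult_left_mono) auto
      also have "\<dots> \<le> \<kappa> / 2" by (rule R)
      finally have "\<kappa> / 2 \<le> Re (coef (nonlin p z) (1, 1))" by linarith
      then have "(4 * g) * (\<kappa> / 2) \<le> (4 * g) * Re (coef (nonlin p z) (1, 1))"
        using g by (intro mult_left_mono) auto
      then show ?thesis by (simp add: damping_of_def)
    qed
    have om_diff: "\<bar>freq_of p m g z - freq_of p m g z'\<bar> \<le> 4 * g * norm (nonlin p z - nonlin p z')" for z z'
    proof -
      have "\<bar>freq_of p m g z - freq_of p m g z'\<bar> \<le> 4 * \<bar>g * Im (coef (nonlin p z) (1, 1)) - g * Im (coef (nonlin p z') (1, 1))\<bar>"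
        unfolding freq_of_def by (rule freq_lipschitz[OF m(1)])
      also have "\<dots> = 4 * (g * \<bar>Im (coef (nonlin p z - nonlin p z') (1, 1))\<bar>)"
        using g by (simp add: abs_mult flip: right_diff_distrib)
      also have "\<dots> \<le> 4 * (g * norm (nonlin p z - nonlin p z'))"
        using g by (intro mult_left_mono order_trans[OF abs_Im_le_cmod cmod_coef_le]) auto
      finally show ?thesis by simp
    qed
    have al_diff: "\<bar>damping_of p g z - damping_of p g z'\<bar> \<le> 4 * g * norm (nonlin p z - nonlin p z')" for z z'
    proof -
      have "\<bar>damping_of p g z - damping_of p g z'\<bar> = 4 * (g * \<bar>Re (coef (nonlin p z - nonlin p z') (1, 1))\<bar>)"
        using g by (simp add: damping_of_def abs_mult flip: right_diff_distrib)
      also have "\<dots> \<le> 4 * (g * norm (nonlin p z - nonlin p z'))"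
        using g by (intro mult_left_mono order_trans[OF abs_Re_le_cmod cmod_coef_le]) auto
      finally show ?thesis by simp
    qed
    have om0: "freq_of p m g 0 = ?w0" by (simp add: freq_of_def nl0 Q0 freq_zero)
    have om_near: "\<bar>freq_of p m g z - ?w0\<bar> \<le> 4 * BQ * g" if "norm z \<le> R" for z
    proof -
      have "\<bar>freq m (g * Im (coef (nonlin p z) (1, 1))) - freq m 0\<bar> \<le> 4 * \<bar>g * Im (coef (nonlin p z) (1, 1)) - 0\<bar>"
        by (rule freq_lipschitz[OF m(1)])
      also have "\<dots> = 4 * (g * \<bar>Im (coef (nonlin p z) (1, 1))\<bar>)" using g by (simp add: abs_mult)
      also have "\<dots> \<le> 4 * (g * BQ)"
        using g by (intro mult_left_mono order_trans[OF abs_Im_le_cmod order_trans[OF cmod_coef_le nl_bd[OF that]]]) auto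
      finally show ?thesis by (simp add: freq_of_def freq_zero mult_ac)
    qed
    have om_half: "?w0 / 2 \<le> freq_of p m g z" if "norm z \<le> R" for z
      using om_near[OF that] gb by linarith
    have div_pos: "divisor m (freq_of p m g z) (damping_of p g z) k \<noteq> 0" if "norm z \<le> R" "fst k \<noteq> 0" "snd k \<noteq> 0" for z k
    proof -
      have "0 < 2 * \<kappa> * g * (\<bar>of_int (fst k)\<bar> * (of_int (snd k))\<^sup>2)" using \<kappa> g that by simp
      also have "\<dots> \<le> cmod (divisor m (freq_of p m g z) (damping_of p g z) k)"
        by (rule imD_lower[OF al[OF that(1)]]) (use \<kappa> g in auto)
      finally show ?thesis by auto
    qed
    have small: "g * \<bar>of_int (fst k)\<bar> \<le> \<theta> * cmod (divisor m (freq_of p m g z) (damping_of p g z) k)"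
      if "norm z \<le> R" "snd k \<noteq> 0" "\<not> resonant k" for z k
      by (rule g1(2)[OF g(1) gb(1) om_near[OF that(1)] al[OF that(1)] that(2,3)])
    have T_bd: "cmod (inv_symbol p m g z k) \<le> \<theta>" if "norm z \<le> R" for z k
    proof (cases "resonant k \<or> snd k = 0 \<or> fst k = 0")
      case True
      then show ?thesis using \<theta> by (auto simp: inv_symbol_def)
    next
      case False
      then have "0 < cmod (divisor m (freq_of p m g z) (damping_of p g z) k)" using div_pos[OF that] by simp
      then show ?thesis using small[OF that, of k] False g
        by (simp add: inv_symbol_def norm_mult norm_divide field_simps)
    qed
    have T_lip: "cmod (inv_symbol p m g z k - inv_symbol p m g z' k) \<le> \<theta> * (16 * C * norm (nonlin p z - nonlin p z'))"
      if z: "norm z \<le> R" "norm z' \<le> R" for z z' k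
    proof (cases "resonant k \<or> snd k = 0 \<or> fst k = 0")
      case True
      then show ?thesis using \<theta> C by (auto simp: inv_symbol_def)
    next
      case False
      let ?D = "divisor m (freq_of p m g z) (damping_of p g z) k" and ?D' = "divisor m (freq_of p m g z') (damping_of p g z') k"
      let ?E = "norm (nonlin p z - nonlin p z')"
      have D: "?D \<noteq> 0" "?D' \<noteq> 0" using div_pos z False by auto
      have "inv_symbol p m g z k - inv_symbol p m g z' k = \<i> * of_real g * of_int (fst k) * (?D' - ?D) / (?D * ?D')"
        using False D by (simp add: inv_symbol_def field_simps)
      then have "cmod (inv_symbol p m g z k - inv_symbol p m g z' k)
          = (g * \<bar>of_int (fst k)\<bar> / cmod ?D') * (cmod (?D - ?D') / cmod ?D)"
        using g by (simp add: norm_mult norm_divide norm_minus_commute)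
      also have "\<dots> \<le> \<theta> * (16 * C * ?E)"
      proof (intro mult_mono)
        show "g * \<bar>of_int (fst k)\<bar> / cmod ?D' \<le> \<theta>"
          using small[OF z(2), of k] D False by (simp add: divide_le_eq)
        have "cmod (?D - ?D') \<le> 4 * (4 * g * ?E) * full_symbol m k"
          by (rule divisor_diff_le[OF m(1) om_half[OF z(1)] om_half[OF z(2)] om_diff al_diff])
        also have "\<dots> = 16 * ?E * (g * full_symbol m k)" by simp
        also have "\<dots> \<le> 16 * ?E * (C * cmod ?D)"
          using divisor_coercive[OF m(1) om_half[OF z(1)] _ g(1) _ al[OF z(1)]] \<kappa> gb False
          by (intro mult_left_mono) (auto simp: C_def)
        finally show "cmod (?D - ?D') / cmod ?D \<le> 16 * C * ?E"
          using D by (simp add: divide_le_eq mult_ac)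
      qed (use \<theta> in auto)
      finally show ?thesis .
    qed
    have mult_bd: "cmod (inv_symbol p m g z k * coef a k) \<le> \<theta> * cmod (coef a k)" if "norm z \<le> R" for z k a
      using T_bd[OF that] by (simp add: norm_mult mult_right_mono)
    note coef_F = coef_diag[OF mult_bd] and norm_F = norm_diag_le[OF mult_bd]
    have coef_range: "coef (range_map p m g z) k = inv_symbol p m g z k * coef (nonlin p z) k" if "norm z \<le> R" for z k
      unfolding range_map_def by (rule coef_F[OF that])
    have lip: "norm (range_map p m g z - range_map p m g z') \<le> 1 / 2 * norm (z - z')"
      if z: "norm z \<le> R" "norm z' \<le> R" for z z'
    proof -
      let ?E = "norm (nonlin p z - nonlin p z')"
      let ?d = "\<lambda>k. inv_symbol p m g z k - inv_symbol p m g z' k"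
      have d: "cmod (?d k * coef a k) \<le> (\<theta> * (16 * C * ?E)) * cmod (coef a k)" for k a
        using T_lip[OF z] by (simp add: norm_mult mult_right_mono)
      \<comment> \<open>Separate the variation of the nonlinear term from that of the multiplier.\<close>
      have "range_map p m g z - range_map p m g z'
          = diag (inv_symbol p m g z) (nonlin p z - nonlin p z') + diag ?d (nonlin p z')"
        by (rule wiener_eqI)
           (simp add: coef_range z coef_F coef_diag[OF d] algebra_simps)
      then have "norm (range_map p m g z - range_map p m g z')
          \<le> norm (diag (inv_symbol p m g z) (nonlin p z - nonlin p z')) + norm (diag ?d (nonlin p z'))"
        by (metis norm_triangle_ineq)
      also have "\<dots> \<le> \<theta> * ?E + (\<theta> * (16 * C * ?E)) * norm (nonlin p z')"
        by (intro add_mono norm_F[OF z(1)] norm_diag_le[OF d])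
      also have "\<dots> \<le> \<theta> * ?E + (\<theta> * (16 * C * ?E)) * BQ"
        using nl_bd[OF z(2)] \<theta> C by (intro add_left_mono mult_left_mono) auto
      also have "\<dots> = \<theta> * (1 + 16 * C * BQ) * ?E" by (simp add: algebra_simps)
      also have "\<dots> \<le> \<theta> * (1 + 16 * C * BQ) * (L * norm (z - z'))"
        using nl_lip[OF z] \<theta> C BQ by (intro mult_left_mono mult_nonneg_nonneg add_nonneg_nonneg) auto
      also have "\<dots> = \<theta> * ((1 + 16 * C * BQ) * L) * norm (z - z')" by simp
      also have "\<dots> \<le> 1 / 2 * norm (z - z')" using \<theta>(3) by (intro mult_right_mono) auto
      finally show ?thesis .
    qed
    have into: "range_map p m g z \<in> sym_ball R" if z: "z \<in> sym_ball R" for z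
    proof -
      have zR: "norm z \<le> R" using z by (simp add: sym_ball_def)
      have "norm (range_map p m g z) \<le> \<theta> * norm (nonlin p z)"
        unfolding range_map_def by (rule norm_F[OF zR])
      also have "\<dots> \<le> \<theta> * BQ" using nl_bd[OF zR] \<theta> by (intro mult_left_mono) auto
      also have "\<dots> \<le> R" by (rule \<theta>)
      finally have "norm (range_map p m g z) \<le> R" .
      moreover have "herm (coef (range_map p m g z))"
        using herm_nonlin[OF z, of p] unfolding herm_def coef_range[OF zR] inv_symbol_uminus by (metis complex_cnj_mult)
      moreover have "xsym (- 1) (coef (range_map p m g z))"
        using xsym_nonlin[OF z, of p] unfolding xsym_def coef_range[OF zR] inv_symbol_xflip
        by (metis mult.left_commute)
      moreover have "coef (range_map p m g z) k = 0" if "resonant k" for k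
        using that by (simp add: coef_range[OF zR] inv_symbol_def)
      ultimately show ?thesis by (simp add: sym_ball_def)
    qed
    have "\<exists>!z\<in>sym_ball R. range_map p m g z = z"
    proof (rule Banach_fix[OF complete_sym_ball])
      have "0 \<in> sym_ball R" using R by (simp add: sym_ball_def herm_def xsym_def)
      then show "sym_ball R \<noteq> {}" by blast
      show "range_map p m g ` sym_ball R \<subseteq> sym_ball R" using into by blast
      show "dist (range_map p m g z) (range_map p m g z') \<le> 1 / 2 * dist z z'"
        if "z \<in> sym_ball R" "z' \<in> sym_ball R" for z z'
        using lip[of z z'] that by (simp add: dist_norm sym_ball_def)
    qed auto
    then obtain z where z: "z \<in> sym_ball R" "range_map p m g z = z" by blast
    have zR: "norm z \<le> R" using z by (simp add: sym_ball_def)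
    \<comment> \<open>At \<open>z = 0\<close> the frequency is exactly \<open>sqrt (1 + m)\<close>, and irrationality alone bounds the divisors.\<close>
    have T0: "cmod (inv_symbol p m g 0 k * coef (nonlin p 0) k) \<le> K0 * g * cmod (coef (nonlin p 0) k)" for k
    proof (cases "k \<in> S0 \<and> \<not> resonant k \<and> snd k \<noteq> 0")
      case True
      let ?D = "divisor m (freq_of p m g 0) (damping_of p g 0) k"
      have pos: "\<bar>reD m ?w0 k\<bar> > 0" using nonresonant_reD[OF m] True by simp
      have "cmod (inv_symbol p m g 0 k) = g * (\<bar>of_int (fst k)\<bar> / cmod ?D)"
        using True g by (simp add: inv_symbol_def norm_mult norm_divide)
      also have "\<dots> \<le> g * (\<bar>of_int (fst k)\<bar> / \<bar>reD m ?w0 k\<bar>)"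
        using pos reD_le[of m ?w0 k "damping_of p g 0"] g unfolding om0
        by (intro mult_left_mono divide_left_mono mult_pos_pos) auto
      also have "\<dots> \<le> g * K0"
        unfolding K0_def using True g
        by (intro mult_left_mono member_le_sum) (auto simp: S0_def)
      finally show ?thesis unfolding norm_mult by (intro mult_right_mono) (simp_all add: mult.commute)
    next
      case False
      then consider "k \<notin> S0" | "inv_symbol p m g 0 k = 0" by (auto simp: inv_symbol_def)
      then show ?thesis
      proof cases
        case 1
        obtain l j where k: "k = (l, j)" by (cases k)
        have "\<bar>l\<bar> > int (2 * p) + 1 \<or> \<bar>j\<bar> > int (2 * p) + 1" using 1 by (auto simp: S0_def k)
        then have "coef (nonlin p 0) k = 0"
          unfolding nl0 k coef_wpow_q0 using sine_power_coeff_eq_0 by auto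
        then show ?thesis by simp
      qed (use K0 g in simp)
    qed
    have "norm (range_map p m g 0) \<le> K0 * g * norm (nonlin p 0)"
      unfolding range_map_def by (rule norm_diag_le[OF T0])
    also have "\<dots> \<le> K0 * g * BQ" using nl_bd[of 0] R K0 g by (intro mult_left_mono) auto
    finally have F0: "norm (range_map p m g 0) \<le> K0 * g * BQ" .
    have "norm z \<le> norm (range_map p m g z - range_map p m g 0) + norm (range_map p m g 0)"
      using norm_triangle_ineq[of "range_map p m g z - range_map p m g 0" "range_map p m g 0"] z(2) by simp
    also have "\<dots> \<le> 1 / 2 * norm z + K0 * g * BQ"
      using lip[of z 0] zR R F0 by (intro add_mono) auto
    finally have "norm z \<le> 2 * (K0 * BQ) * g" by (simp add: mult_ac)
    also have "\<dots> \<le> K * g" using K g by (intro mult_right_mono) auto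
    finally have zK: "norm z \<le> K * g" .
    have omK: "\<bar>freq_of p m g z - ?w0\<bar> \<le> K * g"
      using om_near[OF zR] mult_right_mono[OF K(3), of g] g by linarith
    show "\<exists>z. z \<in> sym_ball 1 \<and> norm z \<le> K * g \<and> norm (nonlin p z) \<le> K
       \<and> 2 * \<kappa> * g \<le> damping_of p g z \<and> \<bar>freq_of p m g z - sqrt (1 + m)\<bar> \<le> K * g
       \<and> sqrt (1 + m) / 2 \<le> freq_of p m g z
       \<and> (\<forall>k. coef z k = inv_symbol p m g z k * coef (nonlin p z) k)
       \<and> (\<forall>k. fst k \<noteq> 0 \<longrightarrow> snd k \<noteq> 0 \<longrightarrow> divisor m (freq_of p m g z) (damping_of p g z) k \<noteq> 0)"
    proof (intro exI[of _ z] conjI allI impI zK omK al[OF zR] om_half[OF zR] div_pos[OF zR])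
      show "z \<in> sym_ball 1" using z(1) R by (auto simp: sym_ball_def)
      show "norm (nonlin p z) \<le> K" using nl_bd[OF zR] K by linarith
      show "coef z k = inv_symbol p m g z k * coef (nonlin p z) k" for k
        using coef_range[OF zR, of k] z(2) by simp
    qed
  qed
qed

section \<open>From the fixed point to the periodic solution\<close>

text \<open>
  At \<open>(1,1)\<close> this is the definition of frequency and damping; the other three resonant modes follow by
  the symmetries, as \<open>u\<close> is real and odd in \<open>x\<close>.
\<close>

lemma divisor_resonant:
  assumes m: "m > 0" and z: "z \<in> sym_ball R" and k: "resonant k"
  shows "divisor m (freq_of p m g z) (damping_of p g z) k * of_int (fst k * snd k) / 4
       = \<i> * of_int (fst k) * of_real g * coef (nonlin p z) k"
proof -
  let ?Q = "coef (nonlin p z)" and ?D = "divisor m (freq_of p m g z) (damping_of p g z)"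
  have re: "(1 + m) / freq_of p m g z - freq_of p m g z = - 4 * (g * Im (?Q (1, 1)))"
    unfolding freq_of_def by (rule freq_eq[OF m])
  have D: "?D (1, 1) = 4 * \<i> * of_real g * ?Q (1, 1)"
    using re by (simp add: divisor_def reD_def imD_def damping_of_def complex_eq_iff)
  have neg: "?Q (- k) = cnj (?Q k)" and flip: "?Q (xflip k) = - ?Q k" for k
    using herm_nonlin[OF z, of p] xsym_nonlin[OF z, of p] unfolding herm_def xsym_def by (simp_all del: split_paired_All)
  have Q: "?Q (- 1, - 1) = cnj (?Q (1, 1))" "?Q (1, - 1) = - ?Q (1, 1)" "?Q (- 1, 1) = - cnj (?Q (1, 1))"
    using neg[of "(1, 1)"] flip[of "(1, 1)"] flip[of "(- 1, - 1)"] by (simp_all add: xflip_def)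
  have DD: "?D (- 1, - 1) = cnj (?D (1, 1))" "?D (1, - 1) = ?D (1, 1)" "?D (- 1, 1) = cnj (?D (1, 1))"
    using divisor_uminus[of m "freq_of p m g z" "damping_of p g z" "(1, 1)"] divisor_xflip[of m "freq_of p m g z" "damping_of p g z" "(1, 1)"]
      divisor_xflip[of m "freq_of p m g z" "damping_of p g z" "(- 1, - 1)"] by (simp_all add: xflip_def)
  from k show ?thesis
    unfolding resonant_iff resonant_modes_def by (auto simp: Q DD D)
qed

text \<open>
  Reduction of the differential equation to its Fourier coefficients: the linear part is the divisor, and
  the power of the velocity is the convolution power of its coefficients.
\<close>

lemma damped_wave_solution_ev:
  assumes h: "herm (coef U)" "herm (coef q)" and x: "xsym (- 1) (coef U)"
    and vel: "\<And>k. \<i> * of_real w * of_int (fst k) * coef U k = coef q k"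
    and eq: "\<And>k. of_real w * divisor m w \<alpha> k * coef U k = coef (wpow q (2 * p)) k" and w: "w > 0"
  shows "damped_wave_solution p m \<alpha> (ev w (coef U))"
proof -
  define a1 a2 b1 b2 b3 where "a1 = (\<lambda>k. (\<i> * of_real w * of_int (fst k)) * coef U k)"
    and "a2 = (\<lambda>k. (\<i> * of_real w * of_int (fst k)) * a1 k)"
    and "b1 = (\<lambda>k. (\<i> * of_int (snd k)) * coef U k)"
    and "b2 = (\<lambda>k. (\<i> * of_int (snd k)) * b1 k)"
    and "b3 = (\<lambda>k. (\<i> * of_real w * of_int (fst k)) * b2 k)"
  note defs = a1_def a2_def b1_def b2_def b3_def
  have r: "rapid a1" "rapid a2" "rapid b1" "rapid b2" "rapid b3"
    unfolding defs by (intro rapid_fst rapid_snd rapid_coef)+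
  have rc: "rapid (\<lambda>k. complex_of_real c * a k)" if "rapid a" for c a
    by (rule rapid_mult[OF that, where C = "\<bar>c\<bar>" and N = 0]) simp
  have "ev w a2 t x - ev w b2 t x - \<alpha> * ev w b3 t x + m * ev w (coef U) t x = ev w a1 t x ^ (2 * p + 1)" for t x
  proof -
    have a1: "a1 = coef q" using vel by (auto simp: a1_def fun_eq_iff mult.assoc)
    have "ev w a2 t x - ev w b2 t x - \<alpha> * ev w b3 t x + m * ev w (coef U) t x
      = ev w a2 t x + (ev w (\<lambda>k. of_real (- 1) * b2 k) t x
          + (ev w (\<lambda>k. of_real (- \<alpha>) * b3 k) t x + ev w (\<lambda>k. of_real m * coef U k) t x))"
      unfolding ev_cmult by simp
    also have "\<dots> = ev w (\<lambda>k. a2 k + (of_real (- 1) * b2 k + (of_real (- \<alpha>) * b3 k + of_real m * coef U k))) t x"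
      by (simp only: ev_add rapid_add r rc rapid_coef)
    also have "(\<lambda>k. a2 k + (of_real (- 1) * b2 k + (of_real (- \<alpha>) * b3 k + of_real m * coef U k)))
        = coef (wpow q (2 * p))"
    proof
      fix k
      have wD: "of_real w * divisor m w \<alpha> k = of_real (- (w\<^sup>2) * (of_int (fst k))\<^sup>2 + (of_int (snd k))\<^sup>2 + m)
          + \<i> * of_real (\<alpha> * w * of_int (fst k) * (of_int (snd k))\<^sup>2)"
        using w by (simp add: complex_eq_iff divisor_def reD_def imD_def field_simps power2_eq_square)
      show "a2 k + (of_real (- 1) * b2 k + (of_real (- \<alpha>) * b3 k + of_real m * coef U k)) = coef (wpow q (2 * p)) k"
        unfolding eq[symmetric] wD by (simp add: defs algebra_simps power2_eq_square)
    qed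
    also have "ev w (coef (wpow q (2 * p))) t x = ev w a1 t x ^ (2 * p + 1)"
      unfolding a1 ev_def[of w "coef (wpow q (2 * p))"] evc_wpow evc_real[OF h(2)]
      by (simp flip: of_real_mult of_real_power)
    finally show ?thesis .
  qed
  moreover have "has_dt (ev w (coef U)) (ev w a1)" "has_dt (ev w a1) (ev w a2)"
    "has_dx (ev w (coef U)) (ev w b1)" "has_dx (ev w b1) (ev w b2)" "has_dt (ev w b2) (ev w b3)"
    unfolding a2_def b2_def b3_def a1_def b1_def
    by (intro has_dt_ev has_dx_ev rapid_fst rapid_snd rapid_coef)+
  ultimately show ?thesis
    unfolding damped_wave_solution_def using periodic_x_ev ev_dirichlet[OF x] by blast
qed

text \<open>
  The solution is recovered from its velocity by integration in time, except for the time-independent modes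
  \<open>l = 0\<close>, which the velocity does not see. There the equation reads \<open>(j\<^sup>2 + m) U = (\<partial>\<^sub>t u)\<^sup>2\<^sup>p\<^sup>+\<^sup>1\<close>, whence the
  second symbol below.
\<close>

definition primitive_symbol :: "int \<times> int \<Rightarrow> complex" where
  "primitive_symbol k = (if fst k = 0 then 0 else 1 / (\<i> * of_int (fst k)))"

definition static_symbol :: "real \<Rightarrow> int \<times> int \<Rightarrow> complex" where
  "static_symbol m k = (if fst k = 0 then 1 / of_real ((of_int (snd k))\<^sup>2 + m) else 0)"

lemma primitive_bound: "cmod (primitive_symbol k * coef a k) \<le> 1 * cmod (coef a k)"
proof (cases "fst k = 0")
  case False
  then have "1 \<le> \<bar>fst k\<bar>" by linarith
  then have "(1::real) \<le> \<bar>of_int (fst k)\<bar>" by (metis of_int_1_le_iff of_int_abs)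
  then have "cmod (primitive_symbol k) \<le> 1" by (simp add: primitive_symbol_def norm_divide norm_mult)
  then show ?thesis unfolding norm_mult by (intro mult_right_mono) auto
qed (simp add: primitive_symbol_def)

lemma static_bound:
  assumes "m > 0"
  shows "cmod (static_symbol m k * coef a k) \<le> 1 / m * cmod (coef a k)"
proof -
  have "cmod (static_symbol m k) \<le> 1 / m"
  proof (cases "fst k = 0")
    case True
    have "0 < (of_int (snd k))\<^sup>2 + m" using assms by (intro add_nonneg_pos) auto
    then have "cmod (static_symbol m k) = 1 / ((of_int (snd k))\<^sup>2 + m)"
      using True by (simp add: static_symbol_def norm_divide del: of_real_add)
    also have "\<dots> \<le> 1 / m" using assms by (intro divide_left_mono mult_pos_pos add_nonneg_pos) auto
    finally show ?thesis .
  qed (use assms in \<open>simp add: static_symbol_def\<close>)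
  then show ?thesis unfolding norm_mult by (intro mult_right_mono) auto
qed

lemma
  assumes "\<And>k a. cmod (f k * coef a k) \<le> C * cmod (coef a k)"
  shows herm_diag: "(\<And>k. f (- k) = cnj (f k)) \<Longrightarrow> herm (coef a) \<Longrightarrow> herm (coef (diag f a))"
    and xsym_diag: "(\<And>k. f (xflip k) = f k) \<Longrightarrow> xsym r (coef a) \<Longrightarrow> xsym r (coef (diag f a))"
  unfolding herm_def xsym_def coef_diag[OF assms]
  by (metis complex_cnj_mult) (metis mult.left_commute)

text \<open>
  The bound on \<open>V\<close> has three sources: the amplitude defect \<open>r / w - \<rho>\<close>, the primitive of the correction \<open>z\<close>,
  and the time-independent modes. Each of them is \<open>O(\<rho> g)\<close>.
\<close>

proposition periodic_solution:
  assumes m: "m > 0" "m \<notin> \<rat>" and "p \<ge> 1"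
  shows "\<exists>M c C. M > 0 \<and> c > 0 \<and> C > 0 \<and> (\<forall>\<rho>. 0 < \<rho> \<longrightarrow> \<rho> < M \<longrightarrow> (\<exists>\<alpha> w U V.
     \<alpha> \<ge> c * \<rho> ^ (2 * p) \<and> w > 0 \<and> \<bar>w - sqrt (1 + m)\<bar> \<le> C * \<rho> \<and> damped_wave_solution p m \<alpha> (ev w (coef U))
     \<and> herm (coef V) \<and> U = \<rho> *\<^sub>R e0 + V \<and> norm V \<le> C * \<rho> ^ (2 * p + 1)))"
proof -
  define w0 where "w0 = sqrt (1 + m)"
  have w0: "w0 \<ge> 1" using m by (simp add: w0_def)
  obtain g0 \<kappa> K where pos: "g0 > 0" "\<kappa> > 0" "K > 0" and fp: "\<And>g. 0 < g \<Longrightarrow> g < g0 \<Longrightarrow>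
     (\<exists>z. z \<in> sym_ball 1 \<and> norm z \<le> K * g \<and> norm (nonlin p z) \<le> K
       \<and> \<kappa> * g \<le> damping_of p g z \<and> \<bar>freq_of p m g z - sqrt (1 + m)\<bar> \<le> K * g
       \<and> sqrt (1 + m) / 2 \<le> freq_of p m g z
       \<and> (\<forall>k. coef z k = inv_symbol p m g z k * coef (nonlin p z) k)
       \<and> (\<forall>k. fst k \<noteq> 0 \<longrightarrow> snd k \<noteq> 0 \<longrightarrow> divisor m (freq_of p m g z) (damping_of p g z) k \<noteq> 0))"
    using fixed_point[OF m, of p] by auto
  define M where "M = min (1 / w0) (g0 / w0)"
  define C1 where "C1 = 2 * K * norm e0 + 2 * K + w0 * K / m"
  have C1: "C1 \<ge> 0" unfolding C1_def using pos w0 m by (intro add_nonneg_nonneg) auto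
  define C where "C = C1 * w0 ^ (2 * p) + K * w0 + 1"
  have C: "C > 0" "C1 * w0 ^ (2 * p) \<le> C" "K * w0 \<le> C"
    using pos w0 C1 by (auto simp: C_def intro!: add_nonneg_pos add_nonneg_nonneg)
  show ?thesis
  proof (rule exI[of _ M], rule exI[of _ "\<kappa> * w0 ^ (2 * p)"], rule exI[of _ C], intro conjI allI impI C(1))
    show "M > 0" using pos w0 by (simp add: M_def)
    show "\<kappa> * w0 ^ (2 * p) > 0" using pos w0 by simp
    fix \<rho> :: real assume \<rho>: "0 < \<rho>" "\<rho> < M"
    define r where "r = \<rho> * w0"
    define g where "g = r ^ (2 * p)"
    have r: "0 < r" "r < 1" "r < g0" using \<rho> w0 by (auto simp: r_def M_def field_simps)
    have g: "0 < g" using r by (simp add: g_def)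
    have "g \<le> r ^ 1" unfolding g_def using r \<open>p \<ge> 1\<close> by (intro power_decreasing) auto
    then have gr: "g \<le> r" by simp
    obtain z where z: "z \<in> sym_ball 1" "norm z \<le> K * g" "norm (nonlin p z) \<le> K" "\<kappa> * g \<le> damping_of p g z"
      and omz: "\<bar>freq_of p m g z - w0\<bar> \<le> K * g" "w0 / 2 \<le> freq_of p m g z"
      and fixz: "\<And>k. coef z k = inv_symbol p m g z k * coef (nonlin p z) k"
      and nz: "\<And>k. fst k \<noteq> 0 \<Longrightarrow> snd k \<noteq> 0 \<Longrightarrow> divisor m (freq_of p m g z) (damping_of p g z) k \<noteq> 0"
      using fp[of g] g gr r unfolding w0_def by auto
    define w \<alpha> where "w = freq_of p m g z" and "\<alpha> = damping_of p g z"
    have w: "w > 0" "w0 / 2 \<le> w" using omz w0 by (auto simp: w_def)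
    define q where "q = r *\<^sub>R (q0 + z)"
    \<comment> \<open>The resonant part \<open>r / w\<close> times \<open>e0\<close> is split into the prescribed amplitude and a defect.\<close>
    define W where "W = (r / w) *\<^sub>R diag primitive_symbol z + (r * g) *\<^sub>R diag (static_symbol m) (nonlin p z)"
    define V where "V = (r / w - \<rho>) *\<^sub>R e0 + W"
    define U where "U = \<rho> *\<^sub>R e0 + V"
    have Q: "herm (coef (nonlin p z))" "xsym (- 1) (coef (nonlin p z))"
      by (rule herm_nonlin[OF z(1)], rule xsym_nonlin[OF z(1)])
    have zs: "herm (coef z)" "xsym (- 1) (coef z)" and z_res: "\<And>k. resonant k \<Longrightarrow> coef z k = 0"
      using z(1) by (simp_all add: sym_ball_def del: split_paired_All)
    have W: "herm (coef W)" "xsym (- 1) (coef W)"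
      unfolding W_def
      by (intro herm_add xsym_add herm_scaleR xsym_scaleR herm_diag[OF primitive_bound] herm_diag[OF static_bound[OF m(1)]]
          xsym_diag[OF primitive_bound] xsym_diag[OF static_bound[OF m(1)]] zs Q;
          simp add: primitive_symbol_def static_symbol_def xflip_def)+
    have V: "herm (coef V)" "xsym (- 1) (coef V)"
      unfolding V_def by (intro herm_add xsym_add herm_scaleR xsym_scaleR herm_e0 xsym_e0 W)+
    have U: "herm (coef U)" "xsym (- 1) (coef U)"
      unfolding U_def by (intro herm_add xsym_add herm_scaleR xsym_scaleR herm_e0 xsym_e0 V)+
    have q: "herm (coef q)"
      unfolding q_def by (intro herm_scaleR herm_add herm_q0 zs)
    have coefU: "coef U k = of_real (r / w) * (coef e0 k + primitive_symbol k * coef z k)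
        + of_real (r * g) * (static_symbol m k * coef (nonlin p z) k)" for k
      by (simp add: U_def V_def W_def coef_diag[OF primitive_bound] coef_diag[OF static_bound[OF m(1)]]
          scaleR_conv_of_real algebra_simps)
    have vel: "\<i> * of_real w * of_int (fst k) * coef U k = coef q k" for k
    proof (cases "fst k = 0")
      case True
      then show ?thesis using fixz[of k] by (simp add: q_def coef_q0 resonant_def inv_symbol_def)
    next
      case False
      have "\<i> * of_int (fst k) * coef e0 k = coef q0 k"
        by (simp add: coef_e0 coef_q0 complex_eq_iff)
      moreover have "\<i> * of_int (fst k) * (primitive_symbol k * coef z k) = coef z k"
        using False by (simp add: primitive_symbol_def)
      ultimately have "\<i> * of_int (fst k) * (coef e0 k + primitive_symbol k * coef z k) = coef q0 k + coef z k"
        by (simp only: distrib_left)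
      moreover have "\<i> * of_real w * of_int (fst k) * coef U k
          = of_real r * (\<i> * of_int (fst k) * (coef e0 k + primitive_symbol k * coef z k))"
        using False w by (simp add: coefU static_symbol_def field_simps)
      ultimately show ?thesis by (simp add: q_def scaleR_conv_of_real)
    qed
    have wq: "coef (wpow q (2 * p)) k = of_real (r * g) * coef (nonlin p z) k" for k
      by (simp add: q_def wpow_scaleR nonlin_def g_def scaleR_conv_of_real)
    have eq: "of_real w * divisor m w \<alpha> k * coef U k = coef (wpow q (2 * p)) k" for k
    proof -
      let ?Q = "coef (nonlin p z) k"
      \<comment> \<open>In turn: trivial modes by oddness, time-independent modes, the four resonant modes, the range equation.\<close>
      consider "snd k = 0" | "fst k = 0" | "resonant k" "fst k \<noteq> 0" | "fst k \<noteq> 0" "snd k \<noteq> 0" "\<not> resonant k" by blast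
      then show ?thesis
      proof cases
        case 1
        then have "xflip k = k" by (simp add: xflip_def prod_eq_iff)
        moreover have "coef U (xflip k) = - coef U k" "coef (nonlin p z) (xflip k) = - ?Q"
          using U(2) Q(2) unfolding xsym_def by (simp_all del: split_paired_All)
        ultimately have "coef U k = 0" "?Q = 0" by simp_all
        then show ?thesis by (simp add: wq)
      next
        case 2
        have "0 < (of_int (snd k))\<^sup>2 + m" using m by (intro add_nonneg_pos) auto
        then have "of_real ((of_int (snd k))\<^sup>2 + m) \<noteq> (0 :: complex)" by (simp only: of_real_eq_0_iff)
        moreover have "divisor m w \<alpha> k = of_real (((of_int (snd k))\<^sup>2 + m) / w)"
          using 2 by (simp add: divisor_def reD_def imD_def complex_eq_iff)
        moreover have "coef U k = of_real (r * g) * (1 / of_real ((of_int (snd k))\<^sup>2 + m) * ?Q)"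
          using 2 by (simp add: coefU coef_e0 resonant_def primitive_symbol_def static_symbol_def)
        ultimately show ?thesis using w by (simp add: wq del: of_real_add)
      next
        case 3
        have e: "coef U k = of_real (r / w) * (of_int (fst k * snd k) / 4 / (\<i> * of_int (fst k)))"
        proof -
          have "- \<i> * of_int (snd k) / 4 = of_int (fst k * snd k) / 4 / (\<i> * of_int (fst k))"
            using 3(2) by (simp add: eq_divide_eq complex_eq_iff)
          then show ?thesis using 3 z_res[OF 3(1)] by (simp add: coefU coef_e0 static_symbol_def)
        qed
        have "of_real w * divisor m w \<alpha> k * coef U k
            = of_real r * (divisor m w \<alpha> k * of_int (fst k * snd k) / 4) / (\<i> * of_int (fst k))"
          unfolding e using w by (simp add: field_simps)
        also have "\<dots> = of_real (r * g) * ?Q"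
          unfolding w_def \<alpha>_def divisor_resonant[OF m(1) z(1) 3(1)] using 3(2) by (simp add: field_simps)
        finally show ?thesis by (simp add: wq)
      next
        case 4
        let ?D = "divisor m w \<alpha> k"
        have D: "?D \<noteq> 0" using nz[OF 4(1,2)] by (simp add: w_def \<alpha>_def)
        have "coef z k = \<i> * of_real g * of_int (fst k) / ?D * ?Q"
          using fixz[of k] 4 by (simp add: inv_symbol_def w_def \<alpha>_def)
        then have "coef U k = of_real (r / w) * (of_real g / ?D * ?Q)"
          using 4 by (simp add: coefU coef_e0 primitive_symbol_def static_symbol_def)
        then show ?thesis using D w by (simp add: wq)
      qed
    qed
    have sol: "damped_wave_solution p m \<alpha> (ev w (coef U))"
      by (rule damped_wave_solution_ev[OF U(1) q U(2) vel eq w(1)])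
    have rw: "r / w \<le> 2 * \<rho>" using w \<rho> by (simp add: r_def field_simps)
    have "r / w - \<rho> = (\<rho> / w) * (w0 - w)" using w by (simp add: r_def field_simps)
    then have "\<bar>r / w - \<rho>\<bar> = (\<rho> / w) * \<bar>w - w0\<bar>" using w \<rho> by (simp add: abs_mult)
    also have "\<dots> \<le> (2 * \<rho>) * (K * g)"
    proof (intro mult_mono)
      have "\<rho> * 1 \<le> \<rho> * (2 * w)" using w w0 \<rho> by (intro mult_left_mono) auto
      then show "\<rho> / w \<le> 2 * \<rho>" using w by (simp add: field_simps)
    qed (use omz \<rho> in \<open>auto simp: w_def\<close>)
    finally have d: "\<bar>r / w - \<rho>\<bar> \<le> (2 * \<rho>) * (K * g)" .
    have "norm V \<le> norm ((r / w - \<rho>) *\<^sub>R e0) + (norm ((r / w) *\<^sub>R diag primitive_symbol z)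
        + norm ((r * g) *\<^sub>R diag (static_symbol m) (nonlin p z)))"
      unfolding V_def W_def by (intro order_trans[OF norm_triangle_ineq] add_left_mono norm_triangle_ineq)
    also have "\<dots> \<le> (2 * \<rho>) * (K * g) * norm e0 + ((2 * \<rho>) * (1 * (K * g)) + (r * g) * (1 / m * K))"
    proof (intro add_mono)
      show "norm ((r / w - \<rho>) *\<^sub>R e0) \<le> (2 * \<rho>) * (K * g) * norm e0"
        using d by (simp add: mult_right_mono)
      have "norm (diag primitive_symbol z) \<le> 1 * norm z" by (rule norm_diag_le[OF primitive_bound])
      then have "norm (diag primitive_symbol z) \<le> 1 * (K * g)" using z(2) by simp
      then have "(r / w) * norm (diag primitive_symbol z) \<le> (2 * \<rho>) * (1 * (K * g))"
        using rw r w \<rho> by (intro mult_mono) auto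
      moreover have "\<bar>r / w\<bar> = r / w" using r w by simp
      ultimately show "norm ((r / w) *\<^sub>R diag primitive_symbol z) \<le> (2 * \<rho>) * (1 * (K * g))"
        by (simp only: norm_scaleR)
      have "norm (diag (static_symbol m) (nonlin p z)) \<le> 1 / m * norm (nonlin p z)"
        by (rule norm_diag_le[OF static_bound[OF m(1)]])
      also have "\<dots> \<le> 1 / m * K" using z(3) m by (intro mult_left_mono) auto
      finally have "(r * g) * norm (diag (static_symbol m) (nonlin p z)) \<le> (r * g) * (1 / m * K)"
        using r g by (intro mult_left_mono) auto
      then show "norm ((r * g) *\<^sub>R diag (static_symbol m) (nonlin p z)) \<le> (r * g) * (1 / m * K)"
        using r g by (simp add: abs_mult)
    qed
    also have "\<dots> = C1 * (\<rho> * g)" using m by (simp add: C1_def r_def field_simps)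
    also have "\<dots> = (C1 * w0 ^ (2 * p)) * \<rho> ^ (2 * p + 1)"
      by (simp add: g_def r_def power_mult_distrib mult_ac)
    also have "\<dots> \<le> C * \<rho> ^ (2 * p + 1)" using C \<rho> by (intro mult_right_mono) auto
    finally have Vn: "norm V \<le> C * \<rho> ^ (2 * p + 1)" .
    have "K * g \<le> K * r" using gr pos by (intro mult_left_mono) auto
    also have "\<dots> = (K * w0) * \<rho>" by (simp add: r_def)
    also have "\<dots> \<le> C * \<rho>" using C \<rho> by (intro mult_right_mono) auto
    finally have wn: "\<bar>w - sqrt (1 + m)\<bar> \<le> C * \<rho>" using omz by (simp add: w_def w0_def)
    have \<alpha>n: "\<kappa> * w0 ^ (2 * p) * \<rho> ^ (2 * p) \<le> \<alpha>"
      using z(4) by (simp add: \<alpha>_def g_def r_def power_mult_distrib mult_ac)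
    show "\<exists>\<alpha> w U V. \<alpha> \<ge> \<kappa> * w0 ^ (2 * p) * \<rho> ^ (2 * p) \<and> w > 0 \<and> \<bar>w - sqrt (1 + m)\<bar> \<le> C * \<rho>
        \<and> damped_wave_solution p m \<alpha> (ev w (coef U))
        \<and> herm (coef V) \<and> U = \<rho> *\<^sub>R e0 + V \<and> norm V \<le> C * \<rho> ^ (2 * p + 1)"
      using \<alpha>n w(1) wn sol V(1) U_def Vn by blast
  qed
qed

theorem theorem1:
  fixes p k0 :: nat and m \<epsilon> :: real
  assumes "p \<ge> 1" and "m > 0" and "m \<notin> \<rat>" and "k0 \<ge> 2" and "\<epsilon> > 0"
  shows "\<exists>M c C s :: real.
    M > 0 \<and> c > 0 \<and> C > 0 \<and> s \<in> {real k0 + 10 .. real k0 + 20} \<and>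
    (\<forall>\<rho> \<in> {0 <..< M}. \<exists>\<alpha> \<omega> :: real.
       \<alpha> \<ge> c * \<rho> ^ (2 * p) \<and> \<omega> > 0 \<and> \<bar>\<omega> - sqrt (1 + m)\<bar> < \<epsilon> \<and>
       (\<exists>u v :: real \<Rightarrow> real \<Rightarrow> real.
          damped_wave_solution p m \<alpha> u \<and>
          periodic_t (2 * pi / \<omega>) u \<and>
          C_class k0 u \<and>
          (\<forall>t x. u t x = \<rho> * cos (\<omega> * t) * sin x + v (\<omega> * t) x) \<and>
          periodic_t (2 * pi) v \<and>
          in_sobolev s v \<and>
          sobolev_norm s v \<le> C * \<rho> powr (2 * real p + 1 / 2)))"
proof -
  obtain M c C where pos: "M > 0" "c > 0" "C > 0" and ex: "\<And>\<rho>. 0 < \<rho> \<Longrightarrow> \<rho> < M \<Longrightarrow> (\<exists>\<alpha> w U V.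
     \<alpha> \<ge> c * \<rho> ^ (2 * p) \<and> w > 0 \<and> \<bar>w - sqrt (1 + m)\<bar> \<le> C * \<rho> \<and> damped_wave_solution p m \<alpha> (ev w (coef U))
     \<and> herm (coef V) \<and> U = \<rho> *\<^sub>R e0 + V \<and> norm V \<le> C * \<rho> ^ (2 * p + 1))"
    using periodic_solution[OF assms(2,3,1)] by auto
  define N where "N = k0 + 10"
  define M' where "M' = min (min M 1) (\<epsilon> / C)"
  define C' where "C' = fact N * exp 1 * C"
  have C': "C' > 0" using pos by (simp add: C'_def)
  show ?thesis
  proof (rule exI[of _ M'], rule exI[of _ c], rule exI[of _ C'], rule exI[of _ "real N"], intro conjI ballI pos C')
    show "M' > 0" using pos assms by (simp add: M'_def)
    show "real N \<in> {real k0 + 10..real k0 + 20}" by (simp add: N_def)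
    fix \<rho> assume "\<rho> \<in> {0<..<M'}"
    then have \<rho>: "0 < \<rho>" "\<rho> < M" "\<rho> \<le> 1" "C * \<rho> < \<epsilon>" using pos by (auto simp: M'_def field_simps)
    obtain \<alpha> w U V where s: "\<alpha> \<ge> c * \<rho> ^ (2 * p)" "w > 0" "\<bar>w - sqrt (1 + m)\<bar> \<le> C * \<rho>"
      "damped_wave_solution p m \<alpha> (ev w (coef U))" "herm (coef V)"
      and U: "U = \<rho> *\<^sub>R e0 + V" and V: "norm V \<le> C * \<rho> ^ (2 * p + 1)"
      using ex[OF \<rho>(1,2)] by blast
    have split: "ev w (coef U) t x = \<rho> * cos (w * t) * sin x + ev 1 (coef V) (w * t) x" for t x
    proof -
      have "coef U = (\<lambda>k. coef (\<rho> *\<^sub>R e0) k + coef V k)" by (simp add: U fun_eq_iff)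
      then have "ev w (coef U) t x = ev w (coef (\<rho> *\<^sub>R e0)) t x + ev w (coef V) t x"
        by (simp only: ev_add[OF rapid_coef rapid_coef])
      also have "coef (\<rho> *\<^sub>R e0) = (\<lambda>k. of_real \<rho> * coef e0 k)" by (simp add: fun_eq_iff scaleR_conv_of_real)
      finally show ?thesis by (simp only: ev_cmult ev_e0 ev_rescale mult.assoc)
    qed
    have "sobolev_norm (real N) (ev 1 (coef V)) \<le> fact N * exp 1 * norm V"
      by (rule sobolev_norm_ev_le[OF s(5)])
    also have "\<dots> \<le> fact N * exp 1 * (C * \<rho> ^ (2 * p + 1))" using V by (intro mult_left_mono) auto
    also have "\<dots> = C' * \<rho> powr real (2 * p + 1)" 
      unfolding powr_realpow[OF \<rho>(1)] by (simp add: C'_def)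
    also have "\<dots> \<le> C' * \<rho> powr (2 * real p + 1 / 2)"
      using \<rho> C' by (intro mult_left_mono powr_mono') auto
    finally have norm: "sobolev_norm (real N) (ev 1 (coef V)) \<le> C' * \<rho> powr (2 * real p + 1 / 2)" .
    have "\<exists>u v :: real \<Rightarrow> real \<Rightarrow> real.
          damped_wave_solution p m \<alpha> u \<and>
          periodic_t (2 * pi / w) u \<and>
          C_class k0 u \<and>
          (\<forall>t x. u t x = \<rho> * cos (w * t) * sin x + v (w * t) x) \<and>
          periodic_t (2 * pi) v \<and>
          in_sobolev (real N) v \<and>
          sobolev_norm (real N) v \<le> C' * \<rho> powr (2 * real p + 1 / 2)"
    proof (rule exI[of _ "ev w (coef U)"], rule exI[of _ "ev 1 (coef V)"], intro conjI allI s split norm)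
      show "periodic_t (2 * pi / w) (ev w (coef U))" using s(2) by (intro periodic_t_ev) auto
      show "C_class k0 (ev w (coef U))" by (intro C_class_ev rapid_coef)
      show "in_sobolev (real N) (ev 1 (coef V))" by (rule in_sobolev_ev[OF s(5)])
      then show "periodic_t (2 * pi) (ev 1 (coef V))" by (simp add: in_sobolev_def)
    qed
    moreover have "\<bar>w - sqrt (1 + m)\<bar> < \<epsilon>" using s(3) \<rho>(4) by linarith
    ultimately show "\<exists>\<alpha> \<omega>. \<alpha> \<ge> c * \<rho> ^ (2 * p) \<and> \<omega> > 0 \<and> \<bar>\<omega> - sqrt (1 + m)\<bar> < \<epsilon> \<and>
       (\<exists>u v :: real \<Rightarrow> real \<Rightarrow> real.
          damped_wave_solution p m \<alpha> u \<and>
          periodic_t (2 * pi / \<omega>) u \<and>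
          C_class k0 u \<and>
          (\<forall>t x. u t x = \<rho> * cos (\<omega> * t) * sin x + v (\<omega> * t) x) \<and>
          periodic_t (2 * pi) v \<and>
          in_sobolev (real N) v \<and>
          sobolev_norm (real N) v \<le> C' * \<rho> powr (2 * real p + 1 / 2))"
      using s(1,2) by blast
  qed
qed

end
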